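(* Let $\mathcal{H}$ be a Hilbert space, let $f\colon \mathcal{H}\to \mathbb{R}\cup\{\infty\}$ be a proper function with $\bar x\in\operatorname{dom} f$, $\bar y\in \partial f(\bar x)$, and suppose $f$ is sequentially weakly lower semicontinuous around $\bar x$. Let $\kappa\in\mathbb{R}$. Then the following statements are equivalent: (a) $f$ is variationally convex at $\bar x$ for $\bar y$ with modulus $\kappa$. (b) $f$ is prox-regular at $\bar x$ for $\bar y$ and there exist $\epsilon>0$ and a neighborhood $U\times V$ of $(\bar x,\bar y)$ such that $D_f(\partial f)$ is $\kappa$-lower-definite on $U_\epsilon^f\times V$.
   Context: Hilbert spaces are real, with inner product $\langle\cdot,\cdot\rangle$ and norm $\|\cdot\|$; $\mathbb{B}_r(a)$ is the open ball; lsc means (norm) lower semicontinuous; $\operatorname{gph}$ denotes the graph of a set-valued mapping; $\operatorname{dom} f=\{x:f(x)<\infty\}$. Sequential weak lower semicontinuity: $f$ is sequentially weakly lsc at $x$ if $\liminf_n f(x_n)\ge f(x)$ whenever $x_n\rightharpoonup x$ (weakly); it is so around $\bar x$ if this holds at every point $x$ of some neighborhood of $\bar x$. Subdifferentials: for $x\in\operatorname{dom}f$, $\zeta\in\partial_P f(x)$ (proximal subdifferential) iff there are $\eta,\sigma>0$ with $f(y)\ge f(x)+\langle\zeta,y-x\rangle-\frac{\sigma}{2}\|y-x\|^2$ for all $y\in\mathbb{B}_\eta(x)$; $\zeta\in\partial f(x)$ (limiting subdifferential) iff there are $x_n\to x$ and $\zeta_n\rightharpoonup\zeta$ (weakly)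 with $f(x_n)\to f(x)$ and $\zeta_n\in\partial_P f(x_n)$ for all $n$. For $x\notin\operatorname{dom}f$ these sets are empty. Prox-regularity: $f$ is prox-regular at $\bar x$ for $\bar y\in\partial f(\bar x)$ if there are $\epsilon,\sigma>0$ such that for all $x,x'\in\mathbb{B}_\epsilon(\bar x)$ with $|f(x)-f(\bar x)|<\epsilon$ and all $y\in\mathbb{B}_\epsilon(\bar y)$ with $y\in\partial f(x)$ one has $f(x')\ge f(x)+\langle y,x'-x\rangle-\frac{\sigma}{2}\|x'-x\|^2$. A function $g$ on $\mathcal{H}$ is $\sigma$-convex ($\sigma\in\mathbb{R}$) if $g-\frac{\sigma}{2}\|\cdot\|^2$ is convex. For a neighborhood $U$ of $\bar x$ and $\epsilon>0$, $U_\epsilon^f=\{x\in U: f(x)<f(\bar x)+\epsilon\}$. Variational convexity: $f$ is variationally convex at $\bar x$ for $\bar y\in\partial f(\bar x)$ with modulus $\sigma\in\mathbb{R}$ if for some open convex neighborhood $U\times V$ of $(\bar x,\bar y)$ there is a $\sigma$-convex lsc function $\hat f\colon\mathcal{H}\to\mathbb{R}\cup\{\infty\}$ with $\hat f\le f$ on $U$ such that, for some $\epsilon>0$, $(U_\epsilon^f\times V)\cap\operatorname{gph}\partial f=(U\times V)\cap\operatorname{gph}\partial\hat f$ and $f(x)=\hat f(x)$ for all $(x,y)\in(U_\epsilon^f\times V)\cap\operatorname{gph}\partial f$. $f$-attentive graphical derivative: for $(x,y)\in\operatorname{gph}\partial f$ and $u\in\mathcal{H}$, $v\in D_f(\partial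 f)(x,y)(u)$ iff there are $s_k\searrow0$ ($s_k>0$) and $(u_k,v_k)\to(u,v)$ such that $y+s_kv_k\in\partial f(x+s_ku_k)$ for all $k$ and $f(x+s_ku_k)\to f(x)$. $D_f(\partial f)$ is $\kappa$-lower-definite on a set $A\subset\mathcal{H}\times\mathcal{H}$ if $\langle u,v\rangle\ge\kappa\|u\|^2$ for all $(x,y)\in A\cap\operatorname{gph}\partial f$, all $u\in\mathcal{H}$ and all $v\in D_f(\partial f)(x,y)(u)$. *)

theory Defs
  imports "HOL-Analysis.Analysis"
begin

text \<open>
  Functions into the real numbers extended by \<open>\<infinity>\<close> are rendered as functions into
  \<^typ>\<open>ereal\<close> that never take the value \<open>-\<infinity>\<close> (see \<open>proper_fun\<close> and \<open>modulus_convex\<close>).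
  A real Hilbert space is a type of sort \<open>{real_inner, complete_space}\<close>.
\<close>

definition eff_dom :: "('a \<Rightarrow> ereal) \<Rightarrow> 'a set" where
  "eff_dom f = {x. f x < \<infinity>}"

definition proper_fun :: "('a \<Rightarrow> ereal) \<Rightarrow> bool" where
  "proper_fun f \<longleftrightarrow> (\<forall>x. f x \<noteq> -\<infinity>) \<and> eff_dom f \<noteq> {}"

definition lsc_fun :: "('a::topological_space \<Rightarrow> ereal) \<Rightarrow> bool" where
  "lsc_fun f \<longleftrightarrow> (\<forall>x. f x \<le> Liminf (at x) f)"

definition weak_tendsto :: "(nat \<Rightarrow> 'a::real_inner) \<Rightarrow> 'a \<Rightarrow> bool" where
  "weak_tendsto X x \<longleftrightarrow> (\<forall>v. (\<lambda>n. v \<bullet> X n) \<longlonglongrightarrow> v \<bullet> x)"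

definition seq_weakly_lsc_at :: "('a::real_inner \<Rightarrow> ereal) \<Rightarrow> 'a \<Rightarrow> bool" where
  "seq_weakly_lsc_at f x \<longleftrightarrow>
     (\<forall>X. weak_tendsto X x \<longrightarrow> f x \<le> liminf (\<lambda>n. f (X n)))"

definition seq_weakly_lsc_around :: "('a::real_inner \<Rightarrow> ereal) \<Rightarrow> 'a \<Rightarrow> bool" where
  "seq_weakly_lsc_around f xbar \<longleftrightarrow> (\<forall>\<^sub>F x in nhds xbar. seq_weakly_lsc_at f x)"

definition prox_subdiff :: "('a::real_inner \<Rightarrow> ereal) \<Rightarrow> 'a \<Rightarrow> 'a set" where
  "prox_subdiff f x =
     {\<zeta>. x \<in> eff_dom f \<and>
        (\<exists>\<eta>>0. \<exists>\<sigma>>0. \<forall>y\<in>ball x \<eta>.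
            f y \<ge> f x + ereal (\<zeta> \<bullet> (y - x) - \<sigma> / 2 * (norm (y - x))\<^sup>2))}"

definition lim_subdiff :: "('a::real_inner \<Rightarrow> ereal) \<Rightarrow> 'a \<Rightarrow> 'a set" where
  "lim_subdiff f x =
     {\<zeta>. x \<in> eff_dom f \<and>
        (\<exists>X Z. X \<longlonglongrightarrow> x \<and> weak_tendsto Z \<zeta> \<and> (\<lambda>n. f (X n)) \<longlonglongrightarrow> f x \<and>
               (\<forall>n. Z n \<in> prox_subdiff f (X n)))}"

definition gph :: "('a \<Rightarrow> 'b set) \<Rightarrow> ('a \<times> 'b) set" where
  "gph F = {(x, y). y \<in> F x}"

definition prox_regular :: "('a::real_inner \<Rightarrow> ereal) \<Rightarrow> 'a \<Rightarrow> 'a \<Rightarrow> bool" where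
  "prox_regular f xbar ybar \<longleftrightarrow>
     ybar \<in> lim_subdiff f xbar \<and>
     (\<exists>\<epsilon>>0. \<exists>\<sigma>>0. \<forall>x\<in>ball xbar \<epsilon>. \<forall>x'\<in>ball xbar \<epsilon>. \<forall>y\<in>ball ybar \<epsilon>.
        \<bar>f x - f xbar\<bar> < ereal \<epsilon> \<and> y \<in> lim_subdiff f x \<longrightarrow>
        f x' \<ge> f x + ereal (y \<bullet> (x' - x) - \<sigma> / 2 * (norm (x' - x))\<^sup>2))"

text \<open>Weights are strictly positive, so no product \<open>0 * \<infinity>\<close> occurs.\<close>

definition ereal_convex :: "('a::real_vector \<Rightarrow> ereal) \<Rightarrow> bool" where
  "ereal_convex g \<longleftrightarrow>
     (\<forall>x y. \<forall>u>0. \<forall>v>0. u + v = 1 \<longrightarrow>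
        g (u *\<^sub>R x + v *\<^sub>R y) \<le> ereal u * g x + ereal v * g y)"

definition modulus_convex :: "real \<Rightarrow> ('a::real_inner \<Rightarrow> ereal) \<Rightarrow> bool" where
  "modulus_convex \<sigma> g \<longleftrightarrow>
     (\<forall>x. g x \<noteq> -\<infinity>) \<and> ereal_convex (\<lambda>x. g x - ereal (\<sigma> / 2 * (norm x)\<^sup>2))"

definition attentive_nbhd :: "('a \<Rightarrow> ereal) \<Rightarrow> 'a \<Rightarrow> 'a set \<Rightarrow> real \<Rightarrow> 'a set" where
  "attentive_nbhd f xbar U \<epsilon> = {x \<in> U. f x < f xbar + ereal \<epsilon>}"

definition variationally_convex ::
    "('a::real_inner \<Rightarrow> ereal) \<Rightarrow> 'a \<Rightarrow> 'a \<Rightarrow> real \<Rightarrow> bool" where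
  "variationally_convex f xbar ybar \<sigma> \<longleftrightarrow>
     ybar \<in> lim_subdiff f xbar \<and>
     (\<exists>U V. open (U \<times> V) \<and> convex (U \<times> V) \<and> (xbar, ybar) \<in> U \<times> V \<and>
        (\<exists>fhat. modulus_convex \<sigma> fhat \<and> lsc_fun fhat \<and> (\<forall>x\<in>U. fhat x \<le> f x) \<and>
           (\<exists>\<epsilon>>0.
              (attentive_nbhd f xbar U \<epsilon> \<times> V) \<inter> gph (lim_subdiff f) =
                (U \<times> V) \<inter> gph (lim_subdiff fhat) \<and>
              (\<forall>(x, y) \<in> (attentive_nbhd f xbar U \<epsilon> \<times> V) \<inter> gph (lim_subdiff f).
                 f x = fhat x))))"

text \<open>The \<open>f\<close>-attentive graphical derivative of the limiting subdifferential of \<open>f\<close>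
  at \<open>(x, y)\<close>; only meaningful for \<open>(x, y)\<close> in its graph.\<close>

definition attentive_deriv ::
    "('a::real_inner \<Rightarrow> ereal) \<Rightarrow> 'a \<Rightarrow> 'a \<Rightarrow> 'a \<Rightarrow> 'a set" where
  "attentive_deriv f x y u =
     {v. \<exists>s uu vv. (\<forall>k. s k > (0::real)) \<and> s \<longlonglongrightarrow> 0 \<and> uu \<longlonglongrightarrow> u \<and> vv \<longlonglongrightarrow> v \<and>
           (\<forall>k. y + s k *\<^sub>R vv k \<in> lim_subdiff f (x + s k *\<^sub>R uu k)) \<and>
           (\<lambda>k. f (x + s k *\<^sub>R uu k)) \<longlonglongrightarrow> f x}"

definition lower_definite_on ::
    "('a::real_inner \<Rightarrow> ereal) \<Rightarrow> real \<Rightarrow> ('a \<times> 'a) set \<Rightarrow> bool" where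
  "lower_definite_on f \<kappa> A \<longleftrightarrow>
     (\<forall>(x, y) \<in> A \<inter> gph (lim_subdiff f). \<forall>u. \<forall>v\<in>attentive_deriv f x y u.
        u \<bullet> v \<ge> \<kappa> * (norm u)\<^sup>2)"

end

theory Submission
  imports Defs "HOL-Library.Diagonal_Subsequence"
begin

text \<open>
  Write \<open>\<kappa>\<close> for the modulus.  If \<open>f\<close> is variationally convex, then near the reference point the
  attentive graph of \<open>\<partial>f\<close> is a piece of the graph of \<open>\<partial>g\<close> for a \<open>\<kappa>\<close>-convex function \<open>g \<le> f\<close> with
  the same values there.  Subgradients of \<open>g\<close> satisfy a global \<open>\<kappa>\<close>-quadratic subgradient inequality
  (\<open>modulus_convex_lim_subdiff_iff\<close>), which is inherited by \<open>f\<close> and gives prox-regularity; and \<open>\<partial>g\<close>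
  is \<open>\<kappa>\<close>-monotone, so difference quotients of the graph, and their limits, satisfy
  \<open>\<langle>u,v\<rangle> \<ge> \<kappa> \<parallel>u\<parallel>\<^sup>2\<close>.

  For the converse let \<open>T\<close> be the attentive localization of the graph of \<open>\<partial>f\<close>.  It is enough to prove,
  for \<open>(x,y) \<in> T\<close> and all \<open>x'\<close> near the reference point,
  \<open>f(x') \<ge> f(x) + \<langle>y,x'-x\<rangle> + \<kappa>/2 \<parallel>x'-x\<parallel>\<^sup>2\<close>: the supremum of these quadratic minorants is then the
  required \<open>\<kappa>\<close>-convex function.  Three ingredients lead there.

  \<^item> The resolvent \<open>P\<close> of \<open>T\<close>, which sends \<open>x + \<gamma> y\<close> to \<open>x\<close> for \<open>(x,y) \<in> T\<close>, is defined near
    \<open>xbar + \<gamma> ybar\<close>, because \<open>f + \<parallel>\<cdot> - z\<parallel>\<^sup>2/(2\<gamma>)\<close> has a minimizer on a closed ball: bounded sequences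
    have weakly convergent subsequences, and \<open>f\<close> is sequentially weakly lower semicontinuous
    (\<open>ex_local_resolvent\<close>).  Prox-regularity makes \<open>P\<close> single-valued and Lipschitz.

  \<^item> Lower definiteness of the graphical derivative says that every strong limit \<open>u\<close> of difference
    quotients of \<open>P\<close> in a direction \<open>d\<close> satisfies \<open>(1 + \<gamma>\<kappa>) \<parallel>u\<parallel>\<^sup>2 \<le> \<langle>u,d\<rangle>\<close>.  To integrate this
    along segments one could use that Lipschitz curves in a Hilbert space are differentiable almost
    everywhere.  The proof below replaces this by \<open>lipschitz_curve_slope_limit\<close>: if the slope of a
    Lipschitz curve over an interval violates a strongly convex quadratic inequality, then some
    sequence of slopes with a common base point converges strongly to a vector that violates it too.
    It is found by nested intervals whose slopes nearly maximize successively perturbed quadratics, in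
    the spirit of the Borwein-Preiss variational principle.  Hence \<open>P\<close> is cocoercive
    (\<open>cocoercive_if_directionally_cocoercive\<close>).

  \<^item> Consequently the gradient \<open>(z - P z)/\<gamma>\<close> of the Moreau envelope is strongly monotone (in a possibly
    negative sense) with modulus \<open>\<kappa>/(1 + \<gamma>\<kappa>)\<close>, the envelope lies above the corresponding quadratics, and
    undoing the infimal convolution turns these into quadratic minorants of \<open>f\<close> with modulus \<open>\<kappa>\<close>
    (\<open>lower_definite_imp_quadratic_minorant\<close>).

  Finally, surjectivity of the resolvent gives the inclusion of graphs that the supremum does not
  give for free: a subgradient pair of the \<open>\<kappa>\<close>-convex function has the same value of \<open>x + \<gamma> y\<close> as
  some pair in \<open>T\<close>, and \<open>\<kappa>\<close>-monotonicity forces the two pairs to coincide.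
\<close>

section \<open>Weak convergence in Hilbert spaces\<close>

text \<open>
  The uniform boundedness principle: by Baire's theorem one of the closed sets on which all
  functionals \<open>\<bullet> Z n\<close> are bounded by \<open>N\<close> contains a ball.
\<close>

lemma weak_tendsto_bounded:
  fixes Z :: "nat \<Rightarrow> 'a::{real_inner, complete_space}"
  assumes "weak_tendsto Z z"
  shows "\<exists>B. \<forall>n. norm (Z n) \<le> B"
proof -
  define C where "C N = {v::'a. \<forall>n. \<bar>v \<bullet> Z n\<bar> \<le> real N}" for N :: nat
  have closedC: "closed (C N)" for N
  proof -
    have "C N = (\<Inter>n. {v. \<bar>v \<bullet> Z n\<bar> \<le> real N})"
      by (auto simp: C_def)
    also have "closed \<dots>"
      by (intro closed_INT ballI closed_Collect_le continuous_intros)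
    finally show ?thesis .
  qed
  have cover: "(\<Union>N. C N) = UNIV"
  proof -
    have "\<exists>N. v \<in> C N" for v
    proof -
      have "convergent (\<lambda>n. v \<bullet> Z n)"
        using assms unfolding weak_tendsto_def convergent_def by blast
      then have "Bseq (\<lambda>n. v \<bullet> Z n)"
        by (rule convergent_imp_Bseq)
      then obtain K where K: "\<And>n. \<bar>v \<bullet> Z n\<bar> \<le> K"
        unfolding Bseq_def by auto
      obtain N where "K \<le> real N"
        using real_arch_simple by blast
      then have "v \<in> C N"
        using K by (auto simp: C_def intro: order_trans)
      then show ?thesis ..
    qed
    then show ?thesis by auto
  qed
  have "\<exists>N. interior (C N) \<noteq> {}"
  proof (rule ccontr)
    assume "\<nexists>N. interior (C N) \<noteq> {}"
    then have "Met_TC.mtopology interior_of \<Union> (range C) = {}"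
      by (intro Met_TC.metric_Baire_category_alt)
        (auto simp: closedC complete_UNIV)
    then show False
      using cover by simp
  qed
  then obtain N x e where e: "e > 0" "ball x e \<subseteq> C N"
    by (metis ex_in_conv mem_interior)
  show ?thesis
  proof (intro exI allI)
    fix n
    show "norm (Z n) \<le> 4 * real N / e"
    proof (cases "Z n = 0")
      case False
      define v where "v = (e / 2 / norm (Z n)) *\<^sub>R Z n"
      have "norm v = e / 2"
        using False e(1) by (simp add: v_def)
      then have "x + v \<in> ball x e" "x \<in> ball x e"
        using e(1) by (auto simp: dist_norm)
      then have "x + v \<in> C N" "x \<in> C N"
        using e(2) by blast+
      then have "\<bar>(x + v) \<bullet> Z n\<bar> \<le> real N" "\<bar>x \<bullet> Z n\<bar> \<le> real N"
        by (simp_all add: C_def)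
      then have "v \<bullet> Z n \<le> 2 * real N"
        by (simp add: inner_add_left)
      moreover have "v \<bullet> Z n = e / 2 * norm (Z n)"
        using False by (simp add: v_def dot_square_norm power2_eq_square)
      ultimately show ?thesis
        using e(1) by (simp add: field_simps)
    qed (use e(1) in simp)
  qed
qed

text \<open>
  Lets subgradient inequalities pass to the limit along the base points, which converge strongly,
  and the proximal subgradients, which converge only weakly, in the definition of the limiting
  subdifferential.
\<close>

lemma tendsto_inner_weak_strong:
  fixes Z :: "nat \<Rightarrow> 'a::{real_inner, complete_space}"
  assumes Z: "weak_tendsto Z z" and X: "X \<longlonglongrightarrow> x"
  shows "(\<lambda>n. Z n \<bullet> X n) \<longlonglongrightarrow> z \<bullet> x"
proof -
  obtain B where B: "\<And>n. norm (Z n) \<le> B"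
    using weak_tendsto_bounded[OF Z] by blast
  have "(\<lambda>n. Z n \<bullet> (X n - x)) \<longlonglongrightarrow> 0"
  proof (rule Lim_null_comparison)
    show "\<forall>\<^sub>F n in sequentially. norm (Z n \<bullet> (X n - x)) \<le> B * norm (X n - x)"
      using B by (auto intro!: always_eventually order_trans[OF Cauchy_Schwarz_ineq2] mult_right_mono)
    show "(\<lambda>n. B * norm (X n - x)) \<longlonglongrightarrow> 0"
      using X by (auto intro!: tendsto_mult_right_zero tendsto_norm_zero simp: LIM_zero)
  qed
  moreover have "(\<lambda>n. Z n \<bullet> x) \<longlonglongrightarrow> z \<bullet> x"
    using Z by (simp add: weak_tendsto_def inner_commute)
  ultimately have "(\<lambda>n. Z n \<bullet> (X n - x) + Z n \<bullet> x) \<longlonglongrightarrow> 0 + z \<bullet> x"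
    by (rule tendsto_add)
  then show ?thesis
    by (simp add: inner_diff_right)
qed

text \<open>
  The representing vector is the limit of a minimizing sequence of \<open>\<parallel>v\<parallel>\<^sup>2 - 2 L v\<close>, which is
  Cauchy by the parallelogram law.  The subspace may fail to be closed, and the vector is only found in
  its closure.  With \<open>L\<close> the inner product by a fixed vector this is also the existence of the
  orthogonal projection onto the closure.
\<close>

lemma riesz_on_subspace:
  fixes S :: "'a::{real_inner, complete_space} set" and L :: "'a \<Rightarrow> real"
  assumes S: "subspace S"
    and add: "\<And>u v. u \<in> S \<Longrightarrow> v \<in> S \<Longrightarrow> L (u + v) = L u + L v"
    and scale: "\<And>c u. u \<in> S \<Longrightarrow> L (c *\<^sub>R u) = c * L u"
    and bound: "\<And>u. u \<in> S \<Longrightarrow> \<bar>L u\<bar> \<le> M * norm u"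
  shows "\<exists>w\<in>closure S. \<forall>v\<in>S. w \<bullet> v = L v"
proof -
  define q where "q v = v \<bullet> v - 2 * L v" for v
  define I where "I = Inf (q ` S)"
  have lower: "- M\<^sup>2 \<le> q v" if "v \<in> S" for v
  proof -
    have "0 \<le> (norm v - M)\<^sup>2" by simp
    then have "- M\<^sup>2 \<le> (norm v)\<^sup>2 - 2 * (M * norm v)"
      by (simp add: power2_diff algebra_simps)
    also have "\<dots> \<le> q v"
      using bound[OF that] by (simp add: q_def power2_norm_eq_inner)
    finally show ?thesis .
  qed
  have bdd: "bdd_below (q ` S)"
    using lower by (intro bdd_belowI) auto
  have ne: "q ` S \<noteq> {}"
    using subspace_0[OF S] by auto
  have I: "I \<le> q v" if "v \<in> S" for v
    unfolding I_def using bdd that by (intro cInf_lower) auto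
  have "\<exists>v\<in>S. q v < I + inverse (real (Suc n))" for n
    using cInf_lessD[OF ne, of "I + inverse (real (Suc n))"] unfolding I_def by auto
  then obtain v where vS: "\<And>n. v n \<in> S"
    and vI: "\<And>n. q (v n) < I + inverse (real (Suc n))"
    by metis
  have par: "(norm (a - b))\<^sup>2 \<le> 2 * (q a - I) + 2 * (q b - I)" if "a \<in> S" "b \<in> S" for a b
  proof -
    have mid: "(1/2) *\<^sub>R (a + b) \<in> S"
      using S that by (simp add: subspace_add subspace_scale)
    have "L ((1/2) *\<^sub>R (a + b)) = (L a + L b) / 2"
      using that S by (simp add: add scale subspace_add)
    then have "q ((1/2) *\<^sub>R (a + b)) = (a \<bullet> a + 2 * (a \<bullet> b) + b \<bullet> b) / 4 - (L a + L b)"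
      unfolding q_def by (simp add: inner_add_left inner_add_right inner_commute field_simps)
    moreover have "(norm (a - b))\<^sup>2 = a \<bullet> a - 2 * (a \<bullet> b) + b \<bullet> b"
      by (simp add: power2_norm_eq_inner inner_diff_left inner_diff_right inner_commute)
    ultimately show ?thesis
      using I[OF mid] unfolding q_def by (simp add: field_simps)
  qed
  have "Cauchy v"
  proof (rule metric_CauchyI)
    fix e :: real assume e: "0 < e"
    obtain N where N: "inverse (real (Suc N)) < e\<^sup>2 / 4"
      using reals_Archimedean[of "e\<^sup>2 / 4"] e by auto
    have small: "q (v k) - I < e\<^sup>2 / 4" if "k \<ge> N" for k
    proof -
      have "inverse (real (Suc k)) \<le> inverse (real (Suc N))"
        using that by (intro le_imp_inverse_le) auto
      then show ?thesis
        using vI[of k] N by linarith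
    qed
    have "dist (v m) (v n) < e" if "m \<ge> N" "n \<ge> N" for m n
    proof -
      have "(norm (v m - v n))\<^sup>2 < 2 * (e\<^sup>2 / 4) + 2 * (e\<^sup>2 / 4)"
        using par[OF vS vS, of m n] small[OF that(1)] small[OF that(2)] by argo
      then have "(norm (v m - v n))\<^sup>2 < e\<^sup>2"
        by simp
      then show ?thesis
        using e by (simp add: dist_norm power2_less_imp_less)
    qed
    then show "\<exists>N. \<forall>m\<ge>N. \<forall>n\<ge>N. dist (v m) (v n) < e" by blast
  qed
  then obtain w where w: "v \<longlonglongrightarrow> w"
    using Cauchy_convergent convergent_def by blast
  have "w \<in> closure S"
    using w vS closure_sequential by blast
  moreover have "w \<bullet> u = L u" if u: "u \<in> S" for u
  proof -
    define c where "c = w \<bullet> u - L u"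
    have var: "0 \<le> t\<^sup>2 * (u \<bullet> u) + 2 * t * c" for t
    proof -
      have "0 \<le> t\<^sup>2 * (u \<bullet> u) + 2 * t * (v n \<bullet> u - L u) + inverse (real (Suc n))" for n
      proof -
        have "L (v n + t *\<^sub>R u) = L (v n) + t * L u"
          using u vS S by (simp add: add scale subspace_scale)
        then have "q (v n + t *\<^sub>R u) = q (v n) + t\<^sup>2 * (u \<bullet> u) + 2 * t * (v n \<bullet> u - L u)"
          unfolding q_def by (simp add: algebra_simps inner_commute power2_eq_square)
        moreover have "I \<le> q (v n + t *\<^sub>R u)"
          using I u vS S by (simp add: subspace_add subspace_scale)
        ultimately show ?thesis
          using vI[of n] by linarith
      qed
      moreover have "(\<lambda>n. t\<^sup>2 * (u \<bullet> u) + 2 * t * (v n \<bullet> u - L u) + inverse (real (Suc n)))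
          \<longlonglongrightarrow> t\<^sup>2 * (u \<bullet> u) + 2 * t * (w \<bullet> u - L u) + 0"
        by (intro tendsto_intros w LIMSEQ_inverse_real_of_nat)
      ultimately show ?thesis
        unfolding c_def by (metis (no_types, lifting) LIMSEQ_le_const add.right_neutral)
    qed
    have "c = 0"
    proof (cases "u = 0")
      case True
      then show ?thesis
        using scale[OF u, of 0] by (simp add: c_def)
    next
      case False
      then have uu: "u \<bullet> u > 0" by simp
      from var[of "- c / (u \<bullet> u)"] have "0 \<le> - (c\<^sup>2 / (u \<bullet> u))"
        using uu by (simp add: power2_eq_square field_simps)
      then show ?thesis
        using uu by (simp add: divide_le_0_iff)
    qed
    then show ?thesis by (simp add: c_def)
  qed
  ultimately show ?thesis by blast
qed

text \<open>
  A diagonal argument makes all \<open>\<langle>X m, X (r k)\<rangle>\<close> converge in \<open>k\<close>.  The limit functional on the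
  span of the sequence is represented by a vector \<open>w\<close>; an arbitrary test vector is replaced by its
  projection onto the closed span.
\<close>

lemma bounded_imp_weakly_convergent_subseq:
  fixes X :: "nat \<Rightarrow> 'a::{real_inner, complete_space}"
  assumes B: "\<And>n. norm (X n) \<le> B"
  shows "\<exists>r x. strict_mono (r::nat \<Rightarrow> nat) \<and> weak_tendsto (X \<circ> r) x"
proof -
  interpret subseqs "\<lambda>m s. convergent (\<lambda>k. X m \<bullet> X (s k))"
  proof
    fix m and s :: "nat \<Rightarrow> nat"
    have "bounded (range (\<lambda>k. X m \<bullet> X (s k)))"
    proof (rule boundedI)
      fix c assume "c \<in> range (\<lambda>k. X m \<bullet> X (s k))"
      then obtain k where "c = X m \<bullet> X (s k)" by auto
      then show "norm c \<le> norm (X m) * B"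
        using Cauchy_Schwarz_ineq2[of "X m" "X (s k)"] B mult_left_mono[OF B norm_ge_zero]
        by (metis order_trans real_norm_def)
    qed
    then obtain l r where "strict_mono (r::nat \<Rightarrow> nat)" "((\<lambda>k. X m \<bullet> X (s k)) \<circ> r) \<longlonglongrightarrow> l"
      using bounded_imp_convergent_subsequence by blast
    then show "\<exists>r'. strict_mono r' \<and> convergent (\<lambda>k. X m \<bullet> X ((s \<circ> r') k))"
      by (auto simp: convergent_def o_def)
  qed
  define r where "r = diagseq"
  have r: "strict_mono r" unfolding r_def by (rule subseq_diagseq)
  have conv: "convergent (\<lambda>k. X m \<bullet> X (r k))" for m
  proof -
    have "convergent (\<lambda>k. X m \<bullet> X ((diagseq \<circ> (+) (Suc m)) k))"
    proof (rule diagseq_holds)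
      fix r s :: "nat \<Rightarrow> nat" and n
      assume "strict_mono r" "convergent (\<lambda>k. X n \<bullet> X (s k))"
      then show "convergent (\<lambda>k. X n \<bullet> X ((s \<circ> r) k))"
        using convergent_subseq_convergent[of "\<lambda>k. X n \<bullet> X (s k)" r] by (simp add: o_def)
    qed
    then have "convergent (\<lambda>k. X m \<bullet> X (r (k + Suc m)))"
      by (simp add: r_def o_def add.commute)
    then show ?thesis
      using convergent_ignore_initial_segment[of "\<lambda>k. X m \<bullet> X (r k)" "Suc m"] by simp
  qed
  define S where "S = span (range X)"
  have S: "subspace S" unfolding S_def by simp
  have convS: "convergent (\<lambda>k. v \<bullet> X (r k))" if "v \<in> S" for v
    using that unfolding S_def
  proof (induction rule: span_induct_alt)
    case base
    then show ?case by (simp add: convergent_const)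
  next
    case (step c x y)
    then have "convergent (\<lambda>k. x \<bullet> X (r k))" using conv by auto
    then have "convergent (\<lambda>k. c * (x \<bullet> X (r k)) + y \<bullet> X (r k))"
      using step convergent_add[OF convergent_mult[OF convergent_const]] by blast
    then show ?case by (simp add: inner_add_left)
  qed
  have nonneg: "0 \<le> B" using B[of 0] norm_ge_zero order_trans by blast
  define L where "L v = lim (\<lambda>k. v \<bullet> X (r k))" for v
  have L: "(\<lambda>k. v \<bullet> X (r k)) \<longlonglongrightarrow> L v" if "v \<in> S" for v
    using convS[OF that] unfolding L_def by (simp add: convergent_LIMSEQ_iff)
  have "\<exists>w\<in>closure S. \<forall>v\<in>S. w \<bullet> v = L v"
  proof (rule riesz_on_subspace[OF S])
    fix u v assume uv: "u \<in> S" "v \<in> S"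
    have "(\<lambda>k. (u + v) \<bullet> X (r k)) \<longlonglongrightarrow> L u + L v"
      using tendsto_add[OF L[OF uv(1)] L[OF uv(2)]] by (simp add: inner_add_left)
    then show "L (u + v) = L u + L v"
      using L[OF subspace_add[OF S uv]] LIMSEQ_unique by blast
  next
    fix c u assume u: "u \<in> S"
    have "(\<lambda>k. (c *\<^sub>R u) \<bullet> X (r k)) \<longlonglongrightarrow> c * L u"
      using tendsto_mult_left[OF L[OF u], of c] by simp
    then show "L (c *\<^sub>R u) = c * L u"
      using L[OF subspace_scale[OF S u]] LIMSEQ_unique by blast
  next
    fix u assume u: "u \<in> S"
    have "\<bar>u \<bullet> X (r k)\<bar> \<le> B * norm u" for k
      using Cauchy_Schwarz_ineq2[of u "X (r k)"] mult_right_mono[OF B[of "r k"] norm_ge_zero[of u]]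
      by (simp add: mult.commute)
    then show "\<bar>L u\<bar> \<le> B * norm u"
      using LIMSEQ_le_const2[OF tendsto_rabs[OF L[OF u]]] by blast
  qed
  then obtain w where wS: "w \<in> closure S" and w: "\<And>v. v \<in> S \<Longrightarrow> w \<bullet> v = L v" by blast
  have "(\<lambda>k. v \<bullet> X (r k)) \<longlonglongrightarrow> v \<bullet> w" for v
  proof -
    \<comment> \<open>\<open>p\<close> is the orthogonal projection of \<open>v\<close>: it pairs with \<open>S\<close> as \<open>v\<close> does\<close>
    have "\<exists>p\<in>closure S. \<forall>u\<in>S. p \<bullet> u = v \<bullet> u"
      by (rule riesz_on_subspace[OF S, where M = "norm v"])
        (auto simp: inner_add_right intro: Cauchy_Schwarz_ineq2)
    then obtain p where pS: "p \<in> closure S" and p: "\<And>u. u \<in> S \<Longrightarrow> p \<bullet> u = v \<bullet> u" by blast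
    have XS: "X n \<in> S" for n unfolding S_def by (simp add: span_base)
    have pw: "p \<bullet> w = v \<bullet> w"
    proof -
      obtain u where u: "\<And>n. u n \<in> S" "u \<longlonglongrightarrow> w"
        using wS closure_sequential by blast
      have "(\<lambda>n. p \<bullet> u n) \<longlonglongrightarrow> p \<bullet> w" "(\<lambda>n. v \<bullet> u n) \<longlonglongrightarrow> v \<bullet> w"
        using u(2) by (auto intro!: tendsto_intros)
      then show ?thesis
        using p u(1) LIMSEQ_unique by auto
    qed
    have "(\<lambda>k. p \<bullet> X (r k)) \<longlonglongrightarrow> p \<bullet> w"
    proof (rule LIMSEQ_I)
      fix e :: real assume e: "0 < e"
      define d where "d = e / (4 * (B + norm w + 1))"
      have d: "d > 0" using e nonneg by (simp add: d_def add_nonneg_pos)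
      obtain u where u: "u \<in> S" "dist u p < d"
        using pS d closure_approachable by blast
      have "(\<lambda>k. u \<bullet> X (r k)) \<longlonglongrightarrow> u \<bullet> w"
        using L[OF u(1)] w[OF u(1)] by (simp add: inner_commute)
      then obtain N where N: "\<And>k. k \<ge> N \<Longrightarrow> \<bar>u \<bullet> X (r k) - u \<bullet> w\<bar> < e / 2"
        using LIMSEQ_D[of _ _ "e/2"] e by fastforce
      have "norm (p \<bullet> X (r k) - p \<bullet> w) < e" if "k \<ge> N" for k
      proof -
        have "\<bar>(p - u) \<bullet> (X (r k) - w)\<bar> \<le> norm (p - u) * norm (X (r k) - w)"
          by (rule Cauchy_Schwarz_ineq2)
        also have "\<dots> \<le> d * (B + norm w + 1)"
          using u(2) norm_triangle_ineq4[of "X (r k)" w] B[of "r k"] d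
          by (intro mult_mono) (auto simp: dist_norm norm_minus_commute)
        also have "\<dots> = e / 4"
          using nonneg by (simp add: d_def field_simps add_nonneg_eq_0_iff)
        finally have "\<bar>(p - u) \<bullet> (X (r k) - w)\<bar> \<le> e / 4" .
        moreover have "p \<bullet> X (r k) - p \<bullet> w = (p - u) \<bullet> (X (r k) - w) + (u \<bullet> X (r k) - u \<bullet> w)"
          by (simp add: algebra_simps)
        ultimately show ?thesis
          using N[OF that] e unfolding real_norm_def by linarith
      qed
      then show "\<exists>N. \<forall>k\<ge>N. norm (p \<bullet> X (r k) - p \<bullet> w) < e" by blast
    qed
    then show ?thesis
      using p[OF XS] pw by simp
  qed
  then have "weak_tendsto (X \<circ> r) w"
    by (simp add: weak_tendsto_def)
  then show ?thesis using r by blast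
qed

section \<open>Convergent slopes of Lipschitz curves\<close>

definition slope :: "(real \<Rightarrow> 'a::real_vector) \<Rightarrow> real \<Rightarrow> real \<Rightarrow> 'a" where
  "slope p s t = (p t - p s) /\<^sub>R (t - s)"

text \<open>
  Satisfied by the functions \<open>\<alpha> \<parallel>u\<parallel>\<^sup>2\<close> plus an affine function.  Stating the exact convexity defect
  avoids carrying the coefficients of the affine part.
\<close>

definition quadratic_convex :: "real \<Rightarrow> ('a::real_inner \<Rightarrow> real) \<Rightarrow> bool" where
  "quadratic_convex \<alpha> \<Phi> \<longleftrightarrow>
     (\<forall>u v. \<forall>\<tau>. \<Phi> ((1 - \<tau>) *\<^sub>R u + \<tau> *\<^sub>R v) =
        (1 - \<tau>) * \<Phi> u + \<tau> * \<Phi> v - \<alpha> * \<tau> * (1 - \<tau>) * (norm (u - v))\<^sup>2)"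

lemma quadratic_convexD:
  "quadratic_convex \<alpha> \<Phi> \<Longrightarrow>
   \<Phi> ((1 - \<tau>) *\<^sub>R u + \<tau> *\<^sub>R v) =
     (1 - \<tau>) * \<Phi> u + \<tau> * \<Phi> v - \<alpha> * \<tau> * (1 - \<tau>) * (norm (u - v))\<^sup>2"
  unfolding quadratic_convex_def by blast

lemma quadratic_convex_norm_inner:
  "quadratic_convex c (\<lambda>u. c * (norm u)\<^sup>2 - u \<bullet> d)"
  unfolding quadratic_convex_def power2_norm_eq_inner
  by (simp add: inner_add_left inner_add_right inner_diff_left inner_diff_right inner_commute
      algebra_simps power2_eq_square)

lemma quadratic_convex_diff:
  assumes "quadratic_convex \<alpha> \<Phi>"
  shows "quadratic_convex (\<alpha> - \<beta>) (\<lambda>u. \<Phi> u - \<beta> * (norm (u - m))\<^sup>2)"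
proof -
  have "(norm ((1 - \<tau>) *\<^sub>R u + \<tau> *\<^sub>R v - m))\<^sup>2 =
      (1 - \<tau>) * (norm (u - m))\<^sup>2 + \<tau> * (norm (v - m))\<^sup>2 - \<tau> * (1 - \<tau>) * (norm (u - v))\<^sup>2"
    for u v :: 'a and \<tau>
    unfolding power2_norm_eq_inner
    by (simp add: inner_add_left inner_add_right inner_diff_left inner_diff_right inner_commute
        algebra_simps power2_eq_square)
  note expand = this
  show ?thesis
    unfolding quadratic_convex_def expand quadratic_convexD[OF assms]
    by (simp add: algebra_simps)
qed

lemma slope_split:
  assumes "a < t" "t < b"
  shows "slope p a b = (1 - (b - t) / (b - a)) *\<^sub>R slope p a t + ((b - t) / (b - a)) *\<^sub>R slope p t b"
proof -
  have "1 - (b - t) / (b - a) = (t - a) / (b - a)"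
    using assms by (simp add: field_simps)
  then have "(1 - (b - t) / (b - a)) *\<^sub>R slope p a t + ((b - t) / (b - a)) *\<^sub>R slope p t b
      = (p t - p a) /\<^sub>R (b - a) + (p b - p t) /\<^sub>R (b - a)"
    using assms by (simp add: slope_def inverse_eq_divide)
  also have "\<dots> = slope p a b"
    by (simp add: slope_def scaleR_add_right[symmetric])
  finally show ?thesis by simp
qed

text \<open>
  The slope over \<open>[a,b]\<close> is a convex combination of the slopes over \<open>[a,t]\<close> and \<open>[t,b]\<close>.  If it
  nearly maximizes \<open>\<Phi>\<close> among all slopes in \<open>[a,b]\<close>, strong convexity forces the two parts to be
  close to each other, hence to the slope over \<open>[a,b]\<close>, as long as the part does not carry too little
  weight.  The condition that \<open>t\<close> lies in the left half bounds the weight of \<open>[t,b]\<close> from below.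
\<close>

lemma near_max_slope_split:
  assumes quad: "quadratic_convex \<alpha> \<Phi>" and \<alpha>: "\<alpha> > 0" and ab: "a < t" "t \<le> (a + b) / 2"
    and near: "\<And>s r. a \<le> s \<Longrightarrow> s < r \<Longrightarrow> r \<le> b \<Longrightarrow> \<Phi> (slope p s r) \<le> \<Phi> (slope p a b) + \<delta>"
  shows "(norm (slope p t b - slope p a b))\<^sup>2 \<le> \<delta> / \<alpha>"
    and "t = (a + b) / 2 \<Longrightarrow> (norm (slope p a t - slope p a b))\<^sup>2 \<le> \<delta> / \<alpha>"
    and "t = (a + b) / 2 \<Longrightarrow> \<Phi> (slope p a b) - \<delta> \<le> \<Phi> (slope p a t)"
proof -
  define \<tau> where "\<tau> = (b - t) / (b - a)"
  have tb: "t < b" using ab by (simp add: field_simps)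
  have \<tau>: "1/2 \<le> \<tau>" "\<tau> < 1"
    using ab tb by (auto simp: \<tau>_def field_simps)
  define u v w where "u = slope p a t" and "v = slope p t b" and "w = slope p a b"
  have w: "w = (1 - \<tau>) *\<^sub>R u + \<tau> *\<^sub>R v"
    unfolding u_def v_def w_def \<tau>_def using slope_split[OF ab(1) tb] .
  have u: "\<Phi> u \<le> \<Phi> w + \<delta>" and v: "\<Phi> v \<le> \<Phi> w + \<delta>"
    unfolding u_def v_def w_def using ab tb by (auto intro!: near)
  have eq: "\<Phi> w = (1 - \<tau>) * \<Phi> u + \<tau> * \<Phi> v - \<alpha> * \<tau> * (1 - \<tau>) * (norm (u - v))\<^sup>2"
    unfolding w by (rule quadratic_convexD[OF quad])
  have up: "(1 - \<tau>) * \<Phi> u + \<tau> * \<Phi> v \<le> \<Phi> w + \<delta>"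
  proof -
    have "(1 - \<tau>) * \<Phi> u + \<tau> * \<Phi> v \<le> (1 - \<tau>) * (\<Phi> w + \<delta>) + \<tau> * (\<Phi> w + \<delta>)"
      using u v \<tau> by (intro add_mono mult_left_mono) auto
    then show ?thesis by (simp add: algebra_simps)
  qed
  then have D: "\<alpha> * \<tau> * (1 - \<tau>) * (norm (u - v))\<^sup>2 \<le> \<delta>"
    using eq by linarith
  have "w - v = (1 - \<tau>) *\<^sub>R (u - v)" unfolding w by (simp add: algebra_simps)
  then have "(norm (v - w))\<^sup>2 = (1 - \<tau>) * ((1 - \<tau>) * (norm (u - v))\<^sup>2)"
    using \<tau> by (simp add: norm_minus_commute[of v w] power_mult_distrib power2_eq_square)
  also have "\<dots> \<le> \<tau> * ((1 - \<tau>) * (norm (u - v))\<^sup>2)"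
    using \<tau> by (intro mult_right_mono) auto
  also have "\<dots> \<le> \<delta> / \<alpha>"
    using D \<alpha> by (simp add: field_simps)
  finally show "(norm (slope p t b - slope p a b))\<^sup>2 \<le> \<delta> / \<alpha>"
    by (simp add: v_def w_def)
  assume t: "t = (a + b) / 2"
  have half: "\<tau> = 1 / 2"
  proof -
    have "b - t = (b - a) / 2" using t by (simp add: field_simps)
    then show ?thesis using ab tb by (simp add: \<tau>_def)
  qed
  have "u - w = (1 / 2) *\<^sub>R (u - v)" unfolding w half by (simp add: algebra_simps) (simp flip: scaleR_add_left)
  then have "(norm (u - w))\<^sup>2 = (1/4) * (norm (u - v))\<^sup>2"
    by (simp add: power_mult_distrib power2_eq_square)
  also have "\<dots> \<le> \<delta> / \<alpha>"
    using D \<alpha> unfolding half by (simp add: field_simps)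
  finally show "(norm (slope p a t - slope p a b))\<^sup>2 \<le> \<delta> / \<alpha>"
    by (simp add: u_def w_def)
  have "0 \<le> \<alpha> * \<tau> * (1 - \<tau>) * (norm (u - v))\<^sup>2"
    using \<alpha> \<tau> by simp
  then have "\<Phi> w \<le> (\<Phi> u + \<Phi> v) / 2"
    using eq unfolding half by simp
  then have "\<Phi> w - \<delta> \<le> \<Phi> u"
 using v by (simp add: field_simps)
  then show "\<Phi> (slope p a b) - \<delta> \<le> \<Phi> (slope p a t)"
    by (simp add: u_def w_def)
qed

lemma ex_near_max_subinterval:
  assumes "a < (b::real)" "\<delta> > 0"
    and bdd: "\<And>s t. a \<le> s \<Longrightarrow> s < t \<Longrightarrow> t \<le> b \<Longrightarrow> G s t \<le> (C::real)"
  shows "\<exists>a' b'. a \<le> a' \<and> a' < b' \<and> b' \<le> b \<and> G a b \<le> G a' b' \<and>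
           (\<forall>s t. a \<le> s \<longrightarrow> s < t \<longrightarrow> t \<le> b \<longrightarrow> G s t \<le> G a' b' + \<delta>)"
proof -
  define S where "S = {G s t | s t. a \<le> s \<and> s < t \<and> t \<le> b}"
  have ne: "S \<noteq> {}" using assms(1) by (auto simp: S_def)
  have "bdd_above S" using bdd by (auto simp: S_def intro!: bdd_aboveI[where M = C])
  then have up: "G s t \<le> Sup S" if "a \<le> s" "s < t" "t \<le> b" for s t
    using that by (auto intro!: cSup_upper simp: S_def)
  show ?thesis
  proof (cases "Sup S \<le> G a b + \<delta>")
    case True
    have "\<forall>s t. a \<le> s \<longrightarrow> s < t \<longrightarrow> t \<le> b \<longrightarrow> G s t \<le> G a b + \<delta>"
      using up True by (meson order_trans)
    then show ?thesis using assms(1) by (intro exI[of _ a] exI[of _ b]) auto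
  next
    case False
    have "Sup S - \<delta> < Sup S" using assms(2) by simp
    then obtain x where "x \<in> S" "Sup S - \<delta> < x"
      using less_cSupD[OF ne] by blast
    then obtain a' b' where *: "a \<le> a'" "a' < b'" "b' \<le> b" "Sup S - \<delta> < G a' b'"
      by (auto simp: S_def)
    have "G s t \<le> G a' b' + \<delta>" if "a \<le> s" "s < t" "t \<le> b" for s t
      using up[OF that] *(4) by linarith
    moreover have "G a b \<le> G a' b'" using False *(4) by linarith
    ultimately show ?thesis using * by blast
  qed
qed

lemma convergent_if_geometric_steps:
  fixes x :: "nat \<Rightarrow> 'a::{real_normed_vector, complete_space}"
  assumes step: "\<And>k. norm (x (Suc k) - x k) \<le> C / 2 ^ k"
  shows "convergent x"
proof -
  have C: "0 \<le> C"
    using order_trans[OF norm_ge_zero step[of 0]] by simp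
  have part: "norm (x (k + n) - x k) \<le> 2 * C / 2 ^ k - 2 * C / 2 ^ (k + n)" for k n
  proof (induction n)
    case (Suc n)
    have "norm (x (k + Suc n) - x k) \<le> norm (x (Suc (k + n)) - x (k + n)) + norm (x (k + n) - x k)"
      using norm_triangle_ineq[of "x (Suc (k + n)) - x (k + n)" "x (k + n) - x k"] by simp
    also have "\<dots> \<le> C / 2 ^ (k + n) + (2 * C / 2 ^ k - 2 * C / 2 ^ (k + n))"
      using step[of "k + n"] Suc by (rule add_mono)
    also have "\<dots> = 2 * C / 2 ^ k - 2 * C / 2 ^ (k + Suc n)"
      by (simp add: field_simps)
    finally show ?case .
  qed simp
  have dist: "dist (x n) (x k) \<le> 2 * C / 2 ^ k" if kn: "k \<le> n" for k n
  proof -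
    obtain j where j: "n = k + j" using le_Suc_ex[OF kn] by blast
    have "0 \<le> 2 * C / 2 ^ (k + j)" using C by simp
    then show ?thesis using part[of k j] unfolding dist_norm j by linarith
  qed
  have "Cauchy x"
    unfolding Cauchy_altdef2
  proof (intro allI impI)
    fix e :: real assume e: "0 < e"
    have "(\<lambda>k. 2 * C * (1 / 2) ^ k) \<longlonglongrightarrow> 0"
      by (intro tendsto_mult_right_zero LIMSEQ_power_zero) simp
    then obtain N where "norm (2 * C * (1 / 2) ^ N - 0) < e"
      using LIMSEQ_D e by blast
    then have "2 * C / 2 ^ N < e" using C by (simp add: power_divide)
    then show "\<exists>N. \<forall>n\<ge>N. dist (x n) (x N) < e"
      using dist by (meson order_le_less_trans)
  qed
  then show ?thesis by (rule Cauchy_convergent)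
qed

text \<open>
  The current slope \<open>m\<close> nearly maximizes \<open>\<Phi>\<close>, so that after subtracting the penalty
  \<open>\<beta> \<parallel>u - m\<parallel>\<^sup>2\<close> all slopes that do at least as well as \<open>m\<close> are close to \<open>m\<close>.
  The next interval is the left half of a nearly maximizing interval
  \<open>[a',r]\<close>, so that all slopes from a point of the next interval to the common right end \<open>r\<close> are
  close to the new slope; \<open>r\<close> stays strictly to the right of the next interval.
\<close>

lemma near_max_slope_step:
  fixes p :: "real \<Rightarrow> 'a::real_inner"
  assumes quad: "quadratic_convex \<alpha> \<Phi>" and \<beta>: "0 < \<beta>" "\<beta> < \<alpha>" and \<delta>': "0 < \<delta>'" and ab: "a < b"
    and bdd: "\<And>s r. a \<le> s \<Longrightarrow> s < r \<Longrightarrow> r \<le> b \<Longrightarrow> \<Phi> (slope p s r) \<le> C"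
    and near: "\<And>s r. a \<le> s \<Longrightarrow> s < r \<Longrightarrow> r \<le> b \<Longrightarrow> \<Phi> (slope p s r) \<le> \<Phi> (slope p a b) + \<delta>"
  defines "\<Phi>' \<equiv> \<lambda>u. \<Phi> u - \<beta> * (norm (u - slope p a b))\<^sup>2"
  shows "\<exists>a' b' r. a \<le> a' \<and> a' < b' \<and> b' < r \<and> r \<le> b \<and> b' - a' \<le> (b - a) / 2 \<and>
     (\<forall>s r. a' \<le> s \<longrightarrow> s < r \<longrightarrow> r \<le> b' \<longrightarrow> \<Phi>' (slope p s r) \<le> \<Phi>' (slope p a' b') + 2 * \<delta>') \<and>
     \<Phi> (slope p a b) - \<delta>' \<le> \<Phi>' (slope p a' b') \<and>
     norm (slope p a' b' - slope p a b) \<le> sqrt (\<delta> / \<beta>) + sqrt (\<delta>' / (\<alpha> - \<beta>)) \<and>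
     (\<forall>t\<in>{a'..b'}. norm (slope p t r - slope p a' b') \<le> 2 * sqrt (\<delta>' / (\<alpha> - \<beta>)))"
proof -
  define m where "m = slope p a b"
  have quad': "quadratic_convex (\<alpha> - \<beta>) \<Phi>'"
    unfolding \<Phi>'_def by (rule quadratic_convex_diff[OF quad])
  have le: "\<Phi>' u \<le> \<Phi> u" for u
    using \<beta> by (simp add: \<Phi>'_def)
  have "\<Phi>' (slope p s r) \<le> C" if "a \<le> s" "s < r" "r \<le> b" for s r
    using le bdd[OF that] by (rule order_trans)
  from ex_near_max_subinterval[where G = "\<lambda>s r. \<Phi>' (slope p s r)", OF ab \<delta>' this]
  obtain A R where AR: "a \<le> A" "A < R" "R \<le> b" and ge: "\<Phi>' m \<le> \<Phi>' (slope p A R)"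
    and near': "\<And>s r. a \<le> s \<Longrightarrow> s < r \<Longrightarrow> r \<le> b \<Longrightarrow> \<Phi>' (slope p s r) \<le> \<Phi>' (slope p A R) + \<delta>'"
    unfolding m_def by auto
  \<comment> \<open>the next interval is \<open>[A,B]\<close>, the left half of \<open>[A,R]\<close>, and \<open>R\<close> is the common right end\<close>
  define B w where "B = (A + R) / 2" and "w = slope p A R"
  have B: "A < B" "B < R" "B \<le> (A + R) / 2" using AR by (auto simp: B_def)
  have nearAR: "\<Phi>' (slope p s r) \<le> \<Phi>' (slope p A R) + \<delta>'" if "A \<le> s" "s < r" "r \<le> R" for s r
    using near' that AR by simp
  have \<alpha>': "\<alpha> - \<beta> > 0" using \<beta> by simp
  have wm: "norm (w - m) \<le> sqrt (\<delta> / \<beta>)"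
  proof (rule real_le_rsqrt)
    have "\<Phi> m \<le> \<Phi> w - \<beta> * (norm (w - m))\<^sup>2"
      using ge by (simp add: \<Phi>'_def m_def w_def)
    moreover have "\<Phi> w \<le> \<Phi> m + \<delta>"
      unfolding w_def m_def using AR by (intro near) auto
    ultimately have "\<beta> * (norm (w - m))\<^sup>2 \<le> \<delta>" by linarith
    then show "(norm (w - m))\<^sup>2 \<le> \<delta> / \<beta>"
      using \<beta> by (simp add: field_simps)
  qed
  have mw: "norm (slope p A B - w) \<le> sqrt (\<delta>' / (\<alpha> - \<beta>))"
    unfolding w_def
    by (intro real_le_rsqrt near_max_slope_split(2)[OF quad' \<alpha>' B(1,3) nearAR]) (auto simp: B_def)
  have val: "\<Phi>' w - \<delta>' \<le> \<Phi>' (slope p A B)"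
    unfolding w_def
    by (intro near_max_slope_split(3)[OF quad' \<alpha>' B(1,3) nearAR]) (auto simp: B_def)
  have tw: "norm (slope p t R - w) \<le> sqrt (\<delta>' / (\<alpha> - \<beta>))" if "t \<in> {A..B}" for t
  proof (cases "t = A")
    case True
    then show ?thesis using \<delta>' \<alpha>' by (simp add: w_def)
  next
    case False
    then have "A < t" "t \<le> (A + R) / 2" using that B by auto
    from near_max_slope_split(1)[OF quad' \<alpha>' this nearAR] show ?thesis
      unfolding w_def by (intro real_le_rsqrt) auto
  qed
  show ?thesis
  proof (intro exI conjI allI impI ballI)
    show "a \<le> A" "A < B" "B < R" "R \<le> b" by fact+
    show "B - A \<le> (b - a) / 2" using AR by (simp add: B_def field_simps)
    show "\<Phi>' (slope p s r) \<le> \<Phi>' (slope p A B) + 2 * \<delta>'" if "A \<le> s" "s < r" "r \<le> B" for s r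
      using nearAR[of s r] that B val unfolding w_def by simp
    show "\<Phi> (slope p a b) - \<delta>' \<le> \<Phi>' (slope p A B)"
      using ge val by (simp add: w_def m_def \<Phi>'_def)
    show "norm (slope p A B - slope p a b) \<le> sqrt (\<delta> / \<beta>) + sqrt (\<delta>' / (\<alpha> - \<beta>))"
      using norm_triangle_ineq[of "slope p A B - w" "w - m"] wm mw by (simp add: m_def)
    show "norm (slope p t R - slope p A B) \<le> 2 * sqrt (\<delta>' / (\<alpha> - \<beta>))" if "t \<in> {A..B}" for t
      using norm_triangle_ineq[of "slope p t R - w" "w - slope p A B"] tw[OF that] mw
      by (simp add: norm_minus_commute)
  qed
qed

text \<open>
  A substitute for almost everywhere differentiability of Lipschitz curves.  Iterating
  \<open>near_max_slope_step\<close> with geometrically decreasing tolerances gives nested intervals whose slopes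
  form a Cauchy sequence.  The intervals shrink to a point \<open>t\<close>, and the slopes from \<open>t\<close> to the
  auxiliary right ends have the same limit.  Penalties only decrease the quadratic function, so its
  value at the slopes, and at their limit, does not drop below half of the initial value \<open>\<gamma>\<close>.
\<close>

lemma lipschitz_curve_slope_limit:
  fixes p :: "real \<Rightarrow> 'a::{real_inner, complete_space}"
  assumes lip: "\<And>s t. s \<in> {0..1} \<Longrightarrow> t \<in> {0..1} \<Longrightarrow> norm (p t - p s) \<le> M * \<bar>t - s\<bar>"
    and c: "0 < c"
    and pos: "0 < c * (norm (p 1 - p 0))\<^sup>2 - (p 1 - p 0) \<bullet> d"
  shows "\<exists>t\<ge>0. \<exists>r u. (\<forall>k. t < r k \<and> r k \<le> 1) \<and> r \<longlonglongrightarrow> t \<and>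
           (\<lambda>k. slope p t (r k)) \<longlonglongrightarrow> u \<and> 0 < c * (norm u)\<^sup>2 - u \<bullet> d"
proof -
  define \<Phi>0 where "\<Phi>0 u = c * (norm u)\<^sup>2 - u \<bullet> d" for u :: 'a
  define \<gamma> where "\<gamma> = \<Phi>0 (slope p 0 1)"
  define \<delta> where "\<delta> = \<gamma> / 4"
  \<comment> \<open>the penalties \<open>\<beta> k\<close> sum to \<open>c / 2\<close>, which leaves the coefficient \<open>\<alpha> k \<ge> c / 2\<close>;
    the tolerances \<open>D k\<close> decrease faster than \<open>\<beta> k\<close>, which makes the slopes converge geometrically\<close>
  define \<alpha> \<beta> D where "\<alpha> k = c / 2 + c / 2 ^ (k + 1)" and "\<beta> k = c / 2 ^ (k + 2)"
    and "D k = \<delta> / 8 ^ k" for k :: nat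
  define S where "S = sqrt (2 * \<delta> / c)"
  have \<gamma>: "0 < \<gamma>" using pos by (simp add: \<gamma>_def \<Phi>0_def slope_def)
  then have \<delta>: "0 < \<delta>" by (simp add: \<delta>_def)
  have D: "0 < D k" for k using \<delta> by (simp add: D_def)
  have \<alpha>\<beta>: "\<alpha> k = c / 2 + 2 * \<beta> k" "\<beta> k = 2 * \<beta> (Suc k)" for k
    by (simp_all add: \<alpha>_def \<beta>_def)
  have \<beta>_pos: "0 < \<beta> k" for k
    using c by (simp add: \<beta>_def)
  have \<beta>: "0 < \<beta> k" "\<beta> k < \<alpha> k" for k
    using \<beta>_pos[of k] \<alpha>\<beta>(1)[of k] c by auto
  have \<alpha>: "\<alpha> (Suc k) = \<alpha> k - \<beta> k" for k
    using \<alpha>\<beta>(1)[of k] \<alpha>\<beta>(1)[of "Suc k"] \<alpha>\<beta>(2)[of k] by simp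
  have err1: "sqrt (2 * D k / \<beta> k) = 2 * S / 2 ^ k" for k
  proof -
    have "2 * D k / \<beta> k = (2 * \<delta> / c) * (2 / 2 ^ k)\<^sup>2"
    proof -
      have "(8::real) ^ k = 2 ^ k * (2 ^ k)\<^sup>2"
        by (simp add: power_mult_distrib[symmetric] power2_eq_square)
      then show ?thesis
        using c by (simp add: D_def \<beta>_def field_simps power2_eq_square)
    qed
    then have "sqrt (2 * D k / \<beta> k) = S * sqrt ((2 / 2 ^ k)\<^sup>2)"
      unfolding S_def by (metis real_sqrt_mult)
    then show ?thesis by simp
  qed
  have err2: "sqrt (D (Suc k) / (\<alpha> k - \<beta> k)) \<le> S / 2 ^ k" for k
  proof -
    have "D (Suc k) / \<alpha> (Suc k) \<le> (\<delta> / (2 ^ k)\<^sup>2) / (c / 2)"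
    proof (rule frac_le)
      have "((2::real) ^ k)\<^sup>2 = 4 ^ k"
        by (simp add: power2_eq_square power_mult_distrib[symmetric])
      also have "\<dots> \<le> 8 ^ k" by (rule power_mono) auto
      also have "\<dots> \<le> 8 ^ Suc k" by simp
      finally show "D (Suc k) \<le> \<delta> / (2 ^ k)\<^sup>2"
        unfolding D_def using \<delta> by (intro divide_left_mono) auto
    qed (use c \<delta> in \<open>auto simp: \<alpha>_def\<close>)
    also have "\<dots> = (2 * \<delta> / c) * (1 / 2 ^ k)\<^sup>2"
      by (simp add: field_simps power2_eq_square)
    finally have "sqrt (D (Suc k) / (\<alpha> k - \<beta> k)) \<le> sqrt ((2 * \<delta> / c) * (1 / 2 ^ k)\<^sup>2)"
      unfolding \<alpha> by (rule real_sqrt_le_mono)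
    also have "\<dots> = S / 2 ^ k"
      unfolding S_def real_sqrt_mult by simp
    finally show ?thesis .
  qed
  have slope_le: "norm (slope p s t) \<le> M" if "0 \<le> s" "s < t" "t \<le> 1" for s t
  proof -
    have "norm (p t - p s) \<le> M * (t - s)"
      using lip[of s t] that by simp
    then show ?thesis
      using that by (simp add: slope_def inverse_eq_divide pos_divide_le_eq)
  qed
  have M: "0 \<le> M" using order_trans[OF norm_ge_zero slope_le[of 0 1]] by simp
  have bdd: "\<Phi>0 (slope p s t) \<le> c * M\<^sup>2 + M * norm d" if "0 \<le> s" "s < t" "t \<le> 1" for s t
  proof -
    have "(norm (slope p s t))\<^sup>2 \<le> M\<^sup>2"
      using slope_le[OF that] by (intro power_mono) auto
    then have "c * (norm (slope p s t))\<^sup>2 \<le> c * M\<^sup>2" using c by simp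
    moreover have "- (slope p s t \<bullet> d) \<le> norm (slope p s t) * norm d"
      using Cauchy_Schwarz_ineq2[of "slope p s t" d] by linarith
    moreover have "norm (slope p s t) * norm d \<le> M * norm d"
      using slope_le[OF that] by (intro mult_right_mono) auto
    ultimately show ?thesis unfolding \<Phi>0_def by linarith
  qed
  \<comment> \<open>a state consists of an interval \<open>[a,b]\<close> and the current penalized function \<open>\<Phi>\<close>\<close>
  define P where "P k = (\<lambda>(a, b, \<Phi>). 0 \<le> a \<and> a < b \<and> b \<le> 1 \<and> quadratic_convex (\<alpha> k) \<Phi> \<and>
      (\<forall>u. \<Phi> u \<le> \<Phi>0 u) \<and>
      (\<forall>s r. a \<le> s \<longrightarrow> s < r \<longrightarrow> r \<le> b \<longrightarrow> \<Phi> (slope p s r) \<le> \<Phi> (slope p a b) + 2 * D k) \<and>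
      \<gamma> - 2 * \<delta> + 2 * \<delta> / 2 ^ k \<le> \<Phi> (slope p a b))" for k
  define Q where "Q k = (\<lambda>(a, b, \<Phi> :: 'a \<Rightarrow> real) (a', b', \<Phi>' :: 'a \<Rightarrow> real).
      a \<le> a' \<and> b' - a' \<le> (b - a) / 2 \<and>
      norm (slope p a' b' - slope p a b) \<le> 3 * S / 2 ^ k \<and>
      (\<exists>r. b' < r \<and> r \<le> b \<and>
         (\<forall>t\<in>{a'..b'}. norm (slope p t r - slope p a' b') \<le> 2 * S / 2 ^ k)))" for k :: nat
  have "\<exists>X. \<forall>k. P k (X k) \<and> Q k (X k) (X (Suc k))"
  proof (rule dependent_nat_choice)
    have "0 < (1::real)" by simp
    from ex_near_max_subinterval[where G = "\<lambda>s r. \<Phi>0 (slope p s r)", OF this \<delta> bdd]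
    obtain a b where ab: "0 \<le> a" "a < b" "b \<le> 1" "\<gamma> \<le> \<Phi>0 (slope p a b)"
      and near: "\<And>s r. 0 \<le> s \<Longrightarrow> s < r \<Longrightarrow> r \<le> 1 \<Longrightarrow> \<Phi>0 (slope p s r) \<le> \<Phi>0 (slope p a b) + \<delta>"
      unfolding \<gamma>_def by auto
    have "quadratic_convex (\<alpha> 0) \<Phi>0"
      using quadratic_convex_norm_inner[of c d] unfolding \<Phi>0_def[abs_def] \<alpha>_def by simp
    moreover have "\<Phi>0 (slope p s r) \<le> \<Phi>0 (slope p a b) + 2 * D 0" if "a \<le> s" "s < r" "r \<le> b" for s r
      using near[of s r] that ab \<delta> by (simp add: D_def)
    ultimately have "P 0 (a, b, \<Phi>0)"
      using ab by (simp add: P_def)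
    then show "\<exists>X. P 0 X" ..
  next
    fix X k assume "P k X"
    then obtain a b \<Phi> where X: "X = (a, b, \<Phi>)" and ab: "0 \<le> a" "a < b" "b \<le> 1"
      and quad: "quadratic_convex (\<alpha> k) \<Phi>" and le: "\<And>u. \<Phi> u \<le> \<Phi>0 u"
      and near: "\<And>s r. a \<le> s \<Longrightarrow> s < r \<Longrightarrow> r \<le> b \<Longrightarrow> \<Phi> (slope p s r) \<le> \<Phi> (slope p a b) + 2 * D k"
      and val: "\<gamma> - 2 * \<delta> + 2 * \<delta> / 2 ^ k \<le> \<Phi> (slope p a b)"
      by (cases X) (auto simp: P_def)
    define \<Phi>' where "\<Phi>' u = \<Phi> u - \<beta> k * (norm (u - slope p a b))\<^sup>2" for u
    have bdd': "\<Phi> (slope p s r) \<le> c * M\<^sup>2 + M * norm d" if "a \<le> s" "s < r" "r \<le> b" for s r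
      using le bdd[of s r] that ab by (meson order_trans)
    from near_max_slope_step[OF quad \<beta>(1,2) D[of "Suc k"] ab(2) bdd' near]
    obtain a' b' r where new: "a \<le> a'" "a' < b'" "b' < r" "r \<le> b" "b' - a' \<le> (b - a) / 2"
      and near': "\<And>s r. a' \<le> s \<Longrightarrow> s < r \<Longrightarrow> r \<le> b' \<Longrightarrow>
        \<Phi>' (slope p s r) \<le> \<Phi>' (slope p a' b') + 2 * D (Suc k)"
      and val': "\<Phi> (slope p a b) - D (Suc k) \<le> \<Phi>' (slope p a' b')"
      and close: "norm (slope p a' b' - slope p a b)
        \<le> sqrt (2 * D k / \<beta> k) + sqrt (D (Suc k) / (\<alpha> k - \<beta> k))"
      and tail: "\<And>t. t \<in> {a'..b'} \<Longrightarrow>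
        norm (slope p t r - slope p a' b') \<le> 2 * sqrt (D (Suc k) / (\<alpha> k - \<beta> k))"
      unfolding \<Phi>'_def by blast
    have "P (Suc k) (a', b', \<Phi>')"
      unfolding P_def prod.case
    proof (intro conjI allI impI)
      show "0 \<le> a'" "a' < b'" "b' \<le> 1" using ab new by auto
      show "quadratic_convex (\<alpha> (Suc k)) \<Phi>'"
        unfolding \<alpha> \<Phi>'_def[abs_def] by (rule quadratic_convex_diff[OF quad])
      show "\<Phi>' u \<le> \<Phi>0 u" for u
        using order_trans[OF _ le[of u], of "\<Phi>' u"] \<beta>_pos[of k] by (simp add: \<Phi>'_def)
      show "\<Phi>' (slope p s r) \<le> \<Phi>' (slope p a' b') + 2 * D (Suc k)"
        if "a' \<le> s" "s < r" "r \<le> b'" for s r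
        using near' that .
      have "D (Suc k) \<le> \<delta> / 2 ^ k"
      proof -
        have "(2::real) ^ k \<le> 8 ^ k" by (rule power_mono) auto
        also have "\<dots> \<le> 8 ^ Suc k" by simp
        finally show ?thesis unfolding D_def using \<delta> by (intro divide_left_mono) auto
      qed
      then show "\<gamma> - 2 * \<delta> + 2 * \<delta> / 2 ^ Suc k \<le> \<Phi>' (slope p a' b')"
        using val val' by simp
    qed
    moreover have "Q k X (a', b', \<Phi>')"
    proof -
      have "norm (slope p a' b' - slope p a b) \<le> 3 * S / 2 ^ k"
        using close err1[of k] err2[of k] by simp
      moreover have "norm (slope p t r - slope p a' b') \<le> 2 * S / 2 ^ k" if "t \<in> {a'..b'}" for t
        using tail[OF that] err2[of k] by simp
      ultimately show ?thesis
        unfolding Q_def X prod.case using new by blast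
    qed
    ultimately show "\<exists>Y. P (Suc k) Y \<and> Q k X Y" by blast
  qed
  then obtain X where XP: "\<And>k. P k (X k)" and XQ: "\<And>k. Q k (X k) (X (Suc k))" by blast
  define a b \<Phi> m where "a k = fst (X k)" and "b k = fst (snd (X k))" and "\<Phi> k = snd (snd (X k))"
    and "m k = slope p (a k) (b k)" for k
  have X: "X k = (a k, b k, \<Phi> k)" for k by (simp add: a_def b_def \<Phi>_def)
  have ab: "0 \<le> a k" "a k < b k" "b k \<le> 1" for k
    using XP[of k] by (auto simp: P_def X)
  have val: "\<gamma> / 2 \<le> \<Phi>0 (m k)" for k
  proof -
    have "\<Phi> k (m k) \<le> \<Phi>0 (m k)" "\<gamma> - 2 * \<delta> + 2 * \<delta> / 2 ^ k \<le> \<Phi> k (m k)"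
      using XP[of k] by (auto simp: P_def X m_def)
    moreover have "0 \<le> 2 * \<delta> / 2 ^ k" using \<delta> by simp
    ultimately show ?thesis by (simp add: \<delta>_def)
  qed
  have a_step: "a k \<le> a (Suc k)" and width_step: "b (Suc k) - a (Suc k) \<le> (b k - a k) / 2"
    and m_step: "norm (m (Suc k) - m k) \<le> 3 * S / 2 ^ k"
    and ex_r: "\<exists>r. b (Suc k) < r \<and> r \<le> b k \<and>
       (\<forall>t\<in>{a (Suc k)..b (Suc k)}. norm (slope p t r - m (Suc k)) \<le> 2 * S / 2 ^ k)" for k
    using XQ[of k] by (auto simp: Q_def X m_def)
  from ex_r obtain r where r: "\<And>k. b (Suc k) < r k" "\<And>k. r k \<le> b k"
    and tail: "\<And>k t. t \<in> {a (Suc k)..b (Suc k)} \<Longrightarrow> norm (slope p t (r k) - m (Suc k)) \<le> 2 * S / 2 ^ k"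
    by metis
  have a_mono: "incseq a" using a_step by (rule incseq_SucI)
  have b_mono: "decseq b" using r by (intro decseq_SucI) (meson less_le_trans less_imp_le)
  have a_le_b: "a i \<le> b j" for i j
    by (meson ab(2) a_mono b_mono decseqD incseqD less_imp_le linear order_trans)
  define t where "t = Sup (range a)"
  have at: "a k \<le> t" for k
    unfolding t_def using a_le_b by (intro cSup_upper) (auto intro!: bdd_aboveI[where M = "b 0"])
  have tb: "t \<le> b k" for k
    unfolding t_def using a_le_b by (intro cSup_least) auto
  have width: "b k - a k \<le> 1 / 2 ^ k" for k
  proof (induction k)
    case 0 then show ?case using ab(1)[of 0] ab(3)[of 0] by simp
  next
    case (Suc k) then show ?case using width_step[of k] by simp
  qed
  obtain u where u: "m \<longlonglongrightarrow> u"
    using convergent_if_geometric_steps[of m "3 * S"] m_step unfolding convergent_def by auto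
  have geo: "(\<lambda>k. C / 2 ^ k) \<longlonglongrightarrow> 0" for C :: real
  proof -
    have "(\<lambda>k. C * (1 / 2) ^ k) \<longlonglongrightarrow> 0"
      by (intro tendsto_mult_right_zero LIMSEQ_power_zero) simp
    then show ?thesis by (simp add: power_divide)
  qed
  have tr: "t < r k" and r1: "r k \<le> 1" for k
    using tb[of "Suc k"] r[of k] ab(3)[of k] by auto
  have "r \<longlonglongrightarrow> t"
  proof (rule LIM_zero_cancel, rule Lim_null_comparison[OF always_eventually geo[of 1]], rule allI)
    fix k show "norm (r k - t) \<le> 1 / 2 ^ k"
      using tr[of k] r(2)[of k] at[of k] width[of k] by simp
  qed
  moreover have "(\<lambda>k. slope p t (r k)) \<longlonglongrightarrow> u"
  proof -
    have "(\<lambda>k. slope p t (r k) - m (Suc k)) \<longlonglongrightarrow> 0"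
      by (rule Lim_null_comparison[OF always_eventually geo[of "2 * S"]])
        (use tail at tb in auto)
    from tendsto_add[OF this LIMSEQ_Suc[OF u]] show ?thesis by simp
  qed
  moreover have "0 < c * (norm u)\<^sup>2 - u \<bullet> d"
  proof -
    have "(\<lambda>k. \<Phi>0 (m k)) \<longlonglongrightarrow> \<Phi>0 u"
      unfolding \<Phi>0_def by (intro tendsto_intros u)
    then have "\<gamma> / 2 \<le> \<Phi>0 u"
      using val by (intro LIMSEQ_le_const) auto
    then show ?thesis using \<gamma> by (simp add: \<Phi>0_def)
  qed
  moreover have "0 \<le> t" using ab(1)[of 0] at[of 0] by linarith
  ultimately show ?thesis
    using tr r1 by blast
qed

section \<open>From infinitesimal to global estimates\<close>

text \<open>
  If the inequality failed for \<open>z1\<close> and \<open>z2\<close>, then the curve \<open>t \<mapsto> P (z1 + t (z2 - z1))\<close> would have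
  a sequence of slopes with a common base point and a strong limit \<open>u\<close> violating it, against the
  assumption on limits of difference quotients.
\<close>

lemma cocoercive_if_directionally_cocoercive:
  fixes P :: "'a::{real_inner, complete_space} \<Rightarrow> 'a"
  assumes Z: "convex Z" "z1 \<in> Z" "z2 \<in> Z"
    and lip: "\<And>z z'. z \<in> Z \<Longrightarrow> z' \<in> Z \<Longrightarrow> norm (P z' - P z) \<le> M * norm (z' - z)"
    and c: "0 < c"
    and dir: "\<And>z d u s. z \<in> Z \<Longrightarrow> (\<And>k. 0 < s k) \<Longrightarrow> (\<And>k. z + s k *\<^sub>R d \<in> Z) \<Longrightarrow>
      s \<longlonglongrightarrow> 0 \<Longrightarrow> (\<lambda>k. (P (z + s k *\<^sub>R d) - P z) /\<^sub>R s k) \<longlonglongrightarrow> u \<Longrightarrow> c * (norm u)\<^sup>2 \<le> u \<bullet> d"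
  shows "c * (norm (P z2 - P z1))\<^sup>2 \<le> (P z2 - P z1) \<bullet> (z2 - z1)"
proof (rule ccontr)
  assume neg: "\<not> ?thesis"
  define d where "d = z2 - z1"
  define p where "p t = P (z1 + t *\<^sub>R d)" for t
  have inZ: "z1 + t *\<^sub>R d \<in> Z" if "t \<in> {0..1}" for t
    using convexD_alt[OF Z, of t] that by (simp add: d_def algebra_simps)
  have "norm (p t - p s) \<le> (M * norm d) * \<bar>t - s\<bar>" if "s \<in> {0..1}" "t \<in> {0..1}" for s t
  proof -
    have "(z1 + t *\<^sub>R d) - (z1 + s *\<^sub>R d) = (t - s) *\<^sub>R d" by (simp add: algebra_simps)
    then show ?thesis
      using lip[OF inZ[OF that(1)] inZ[OF that(2)]] by (simp add: p_def mult.assoc mult.left_commute mult.commute)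
  qed
  moreover have "0 < c * (norm (p 1 - p 0))\<^sup>2 - (p 1 - p 0) \<bullet> d"
    using neg by (simp add: p_def d_def)
  ultimately obtain t r u where t: "0 \<le> t" "\<And>k. t < r k" "\<And>k. r k \<le> 1" "r \<longlonglongrightarrow> t"
    and u: "(\<lambda>k. slope p t (r k)) \<longlonglongrightarrow> u" "0 < c * (norm u)\<^sup>2 - u \<bullet> d"
    using lipschitz_curve_slope_limit[of p "M * norm d" c d] c by blast
  define z where "z = z1 + t *\<^sub>R d"
  have zr: "z + (r k - t) *\<^sub>R d = z1 + r k *\<^sub>R d" for k
    by (simp add: z_def algebra_simps)
  have "c * (norm u)\<^sup>2 \<le> u \<bullet> d"
  proof (rule dir)
    show "z \<in> Z" unfolding z_def using t(1) t(2,3)[of 0] by (intro inZ) auto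
    show "0 < r k - t" for k using t(2)[of k] by simp
    show "z + (r k - t) *\<^sub>R d \<in> Z" for k
      unfolding zr using t(1) t(2,3)[of k] by (intro inZ) auto
    show "(\<lambda>k. r k - t) \<longlonglongrightarrow> 0" using t(4) by (rule LIM_zero)
    show "(\<lambda>k. (P (z + (r k - t) *\<^sub>R d) - P z) /\<^sub>R (r k - t)) \<longlonglongrightarrow> u"
      using u(1) unfolding zr by (simp add: slope_def p_def z_def)
  qed
  then show False using u(2) by simp
qed

text \<open>
  The upper estimate identifies \<open>Q\<close> as the gradient of \<open>e\<close>.  Summing it, read from right to left,
  over a subdivision of the segment into \<open>n + 1\<close> equal pieces gives the claim up to an error of order
  \<open>1/n\<close>.  The modulus \<open>\<rho>\<close> may be negative.
\<close>

lemma strongly_monotone_gradient_imp_quadratic_minorant: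
  fixes e :: "'a::real_inner \<Rightarrow> real"
  assumes Z: "convex Z" "z \<in> Z" "z' \<in> Z"
    and grad: "\<And>v w. v \<in> Z \<Longrightarrow> w \<in> Z \<Longrightarrow> e w \<le> e v + Q v \<bullet> (w - v) + C * (norm (w - v))\<^sup>2"
    and mono: "\<And>v w. v \<in> Z \<Longrightarrow> w \<in> Z \<Longrightarrow> \<rho> * (norm (w - v))\<^sup>2 \<le> (Q w - Q v) \<bullet> (w - v)"
  shows "e z + Q z \<bullet> (z' - z) + \<rho> / 2 * (norm (z' - z))\<^sup>2 \<le> e z'"
proof -
  define d where "d = z' - z"
  define N where "N = (norm d)\<^sup>2"
  have bound: "e z + Q z \<bullet> d + \<rho> / 2 * N + (\<rho> / 2 - C) * N * inverse (real (Suc n)) \<le> e z'" for n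
  proof -
    define h where "h = inverse (real (Suc n))"
    have h: "0 < h" "real (Suc n) * h = 1" by (auto simp: h_def)
    have step: "e z + (real i * h) * (Q z \<bullet> d) + \<rho> * N * h\<^sup>2 * (real i * (real i + 1) / 2) - C * N * h\<^sup>2 * real i
        \<le> e (z + (real i * h) *\<^sub>R d)" if "i \<le> Suc n" for i
      using that
    proof (induction i)
      case (Suc i)
      define v w where "v = z + (real i * h) *\<^sub>R d" and "w = z + (real (Suc i) * h) *\<^sub>R d"
      have in01: "z + (real j * h) *\<^sub>R d \<in> Z" if "j \<le> Suc n" for j
      proof -
        have "real j * h \<le> real (Suc n) * h" using that h by (intro mult_right_mono) auto
        then show ?thesis
          using convexD_alt[OF Z, of "real j * h"] h by (simp add: d_def algebra_simps)
      qed
      have vZ: "v \<in> Z" and wZ: "w \<in> Z"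
        unfolding v_def w_def using Suc.prems by (auto intro!: in01 simp del: of_nat_Suc)
      have wv: "v - w = (- h) *\<^sub>R d" by (simp add: v_def w_def algebra_simps)
      have wz: "w - z = (real (Suc i) * h) *\<^sub>R d" by (simp add: w_def)
      have "e v \<le> e w - h * (Q w \<bullet> d) + C * N * h\<^sup>2"
        using grad[OF wZ vZ] unfolding wv by (simp add: N_def power_mult_distrib mult_ac)
      moreover have "\<rho> * N * (real (Suc i) * h) \<le> (Q w - Q z) \<bullet> d"
      proof -
        have pos: "0 < real (Suc i) * h" using h by simp
        have "(real (Suc i) * h) * (\<rho> * N * (real (Suc i) * h)) \<le> (real (Suc i) * h) * ((Q w - Q z) \<bullet> d)"
          using mono[OF Z(2) wZ] unfolding wz
          by (simp add: N_def power_mult_distrib power2_eq_square mult_ac)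
        then show ?thesis using pos by (simp only: mult_le_cancel_left_pos)
      qed
      then have "h * (\<rho> * N * (real (Suc i) * h)) \<le> h * ((Q w - Q z) \<bullet> d)"
        using h by (intro mult_left_mono) auto
      then have "\<rho> * N * h\<^sup>2 * (real i + 1) + h * (Q z \<bullet> d) \<le> h * (Q w \<bullet> d)"
        by (simp add: inner_diff_left algebra_simps power2_eq_square)
      moreover have "e z + (real i * h) * (Q z \<bullet> d) + \<rho> * N * h\<^sup>2 * (real i * (real i + 1) / 2)
          - C * N * h\<^sup>2 * real i \<le> e v"
        using Suc.IH Suc.prems unfolding v_def by simp
      moreover have "\<rho> * N * h\<^sup>2 * (real (Suc i) * (real (Suc i) + 1) / 2)
          = \<rho> * N * h\<^sup>2 * (real i * (real i + 1) / 2) + \<rho> * N * h\<^sup>2 * (real i + 1)"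
        by (simp add: field_simps)
      moreover have "C * N * h\<^sup>2 * real (Suc i) = C * N * h\<^sup>2 * real i + C * N * h\<^sup>2"
        by (simp add: algebra_simps)
      moreover have "(real (Suc i) * h) * (Q z \<bullet> d) = (real i * h) * (Q z \<bullet> d) + h * (Q z \<bullet> d)"
        by (simp add: algebra_simps)
      ultimately show ?case unfolding w_def[symmetric] by linarith
    qed simp
    have "\<rho> * N * h\<^sup>2 * (real (Suc n) * (real (Suc n) + 1) / 2)
        = \<rho> * N * (real (Suc n) * h) * (real (Suc n) * h + h) / 2"
      by (simp add: field_simps power2_eq_square)
    then have 1: "\<rho> * N * h\<^sup>2 * (real (Suc n) * (real (Suc n) + 1) / 2) = \<rho> / 2 * N + \<rho> / 2 * N * h"
      unfolding h(2) by (simp add: algebra_simps add_divide_distrib)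
    have "C * N * h\<^sup>2 * real (Suc n) = C * N * h * (real (Suc n) * h)"
      by (simp add: power2_eq_square)
    then have 2: "C * N * h\<^sup>2 * real (Suc n) = C * N * h"
      unfolding h(2) by simp
    show ?thesis
      using step[of "Suc n"] unfolding 1 2 unfolding h(2) h_def[symmetric]
      by (simp add: d_def algebra_simps)
  qed
  have "(\<lambda>n. e z + Q z \<bullet> d + \<rho> / 2 * N + (\<rho> / 2 - C) * N * inverse (real (Suc n)))
      \<longlonglongrightarrow> e z + Q z \<bullet> d + \<rho> / 2 * N + (\<rho> / 2 - C) * N * 0"
    by (intro tendsto_intros LIMSEQ_inverse_real_of_nat)
  then have "e z + Q z \<bullet> d + \<rho> / 2 * N + (\<rho> / 2 - C) * N * 0 \<le> e z'"
    by (rule LIMSEQ_le_const2) (use bound in blast)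
  then show ?thesis by (simp add: d_def N_def)
qed

section \<open>Minimizers, subgradients and quadratic envelopes\<close>

text \<open>
  The direct method with weak convergence: balls are weakly closed, and
  \<open>\<parallel>x' - z\<parallel>\<^sup>2 \<ge> \<parallel>x - z\<parallel>\<^sup>2 + 2 \<langle>x - z, x' - x\<rangle>\<close> has a weakly continuous right-hand side.
\<close>

lemma ex_minimizer_on_cball:
  fixes f :: "'a::{real_inner, complete_space} \<Rightarrow> ereal"
  assumes lsc: "\<And>x. x \<in> cball a r \<Longrightarrow> seq_weakly_lsc_at f x" and r: "0 \<le> r" and c: "0 \<le> c"
  shows "\<exists>x\<in>cball a r. \<forall>x'\<in>cball a r.
    f x + ereal (c * (norm (x - z))\<^sup>2) \<le> f x' + ereal (c * (norm (x' - z))\<^sup>2)"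
proof -
  define F where "F x = f x + ereal (c * (norm (x - z))\<^sup>2)" for x
  define I where "I = Inf (F ` cball a r)"
  have "F ` cball a r \<noteq> {}" using r by auto
  then obtain V where V: "\<And>n. V n \<in> F ` cball a r" "V \<longlonglongrightarrow> I"
    using Inf_as_limit[of "F ` cball a r"] unfolding I_def by blast
  from V(1) have "\<forall>n. \<exists>x. x \<in> cball a r \<and> V n = F x" by blast
  then obtain X where X: "\<And>n. X n \<in> cball a r" and VX: "\<And>n. V n = F (X n)" by metis
  have "norm (X n) \<le> norm a + r" for n
    using X[of n] norm_triangle_ineq[of a "X n - a"] by (simp add: dist_norm norm_minus_commute)
  then obtain s x where s: "strict_mono s" and wx: "weak_tendsto (X \<circ> s) x"
    using bounded_imp_weakly_convergent_subseq by blast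
  have lim: "(\<lambda>n. v \<bullet> X (s n)) \<longlonglongrightarrow> v \<bullet> x" for v
    using wx by (simp add: weak_tendsto_def)
  have xB: "x \<in> cball a r"
  proof -
    have "(\<lambda>n. (x - a) \<bullet> X (s n) - (x - a) \<bullet> a) \<longlonglongrightarrow> (x - a) \<bullet> x - (x - a) \<bullet> a"
      by (intro tendsto_intros lim)
    moreover have "(x - a) \<bullet> X (s n) - (x - a) \<bullet> a \<le> norm (x - a) * r" for n
    proof -
      have "(x - a) \<bullet> (X (s n) - a) \<le> norm (x - a) * norm (X (s n) - a)"
        by (rule norm_cauchy_schwarz)
      also have "\<dots> \<le> norm (x - a) * r"
        using X[of "s n"] by (intro mult_left_mono) (auto simp: dist_norm norm_minus_commute)
      finally show ?thesis by (simp add: inner_diff_right)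
    qed
    ultimately have "(x - a) \<bullet> x - (x - a) \<bullet> a \<le> norm (x - a) * r"
      by (intro LIMSEQ_le_const2) auto
    then have "norm (x - a) * norm (x - a) \<le> norm (x - a) * r"
      by (simp add: inner_diff_right[symmetric] dot_square_norm power2_eq_square)
    then show ?thesis
      using r by (auto simp: dist_norm norm_minus_commute mult_le_cancel_left)
  qed
  \<comment> \<open>the weakly continuous minorant of the quadratic term\<close>
  define k where "k n = c * ((norm (x - z))\<^sup>2 + 2 * ((x - z) \<bullet> X (s n) - (x - z) \<bullet> x))" for n
  have kF: "ereal (k n) + f (X (s n)) \<le> F (X (s n))" for n
  proof -
    have "(norm (x - z))\<^sup>2 + 2 * ((x - z) \<bullet> X (s n) - (x - z) \<bullet> x) + (norm (X (s n) - x))\<^sup>2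
        = (norm (X (s n) - z))\<^sup>2"
      by (simp add: power2_norm_eq_inner inner_diff_left inner_diff_right inner_commute algebra_simps)
    then have "(norm (x - z))\<^sup>2 + 2 * ((x - z) \<bullet> X (s n) - (x - z) \<bullet> x) \<le> (norm (X (s n) - z))\<^sup>2"
      by (smt (verit) zero_le_power2)
    then have "k n \<le> c * (norm (X (s n) - z))\<^sup>2"
      unfolding k_def using c by (rule mult_left_mono)
    then show ?thesis
      unfolding F_def by (subst add.commute) (intro add_left_mono, simp)
  qed
  have "k \<longlonglongrightarrow> c * ((norm (x - z))\<^sup>2 + 2 * ((x - z) \<bullet> x - (x - z) \<bullet> x))"
    unfolding k_def by (intro tendsto_intros lim)
  then have k: "(\<lambda>n. ereal (k n)) \<longlonglongrightarrow> ereal (c * (norm (x - z))\<^sup>2)" by simp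
  have "F x = ereal (c * (norm (x - z))\<^sup>2) + f x"
    by (simp add: F_def add.commute)
  also have "\<dots> \<le> ereal (c * (norm (x - z))\<^sup>2) + liminf (\<lambda>n. f (X (s n)))"
    using lsc[OF xB] wx by (intro add_left_mono) (auto simp: seq_weakly_lsc_at_def o_def)
  also have "\<dots> = liminf (\<lambda>n. ereal (k n) + f (X (s n)))"
    using ereal_liminf_lim_add[OF k] by simp
  also have "\<dots> \<le> liminf (\<lambda>n. F (X (s n)))"
    using kF by (intro Liminf_mono always_eventually) auto
  also have "\<dots> = I"
  proof -
    have "(\<lambda>n. F (X (s n))) \<longlonglongrightarrow> I"
      using LIMSEQ_subseq_LIMSEQ[OF V(2) s] by (simp add: VX o_def)
    then show ?thesis by (simp add: lim_imp_Liminf)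
  qed
  finally have "F x \<le> F x'" if "x' \<in> cball a r" for x'
    using that unfolding I_def by (meson INF_lower2 order_refl order_trans)
  then show ?thesis using xB unfolding F_def by blast
qed

lemma prox_subdiff_subset_lim_subdiff: "prox_subdiff f x \<subseteq> lim_subdiff f x"
proof
  fix \<zeta> assume "\<zeta> \<in> prox_subdiff f x"
  then have "x \<in> eff_dom f \<and> (\<lambda>_. x) \<longlonglongrightarrow> x \<and> weak_tendsto (\<lambda>_. \<zeta>) \<zeta> \<and>
      (\<lambda>_. f x) \<longlonglongrightarrow> f x \<and> (\<forall>n::nat. \<zeta> \<in> prox_subdiff f x)"
    by (simp add: weak_tendsto_def prox_subdiff_def)
  then show "\<zeta> \<in> lim_subdiff f x"
    unfolding lim_subdiff_def by fast
qed

lemma ereal_quadratic_weaken: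
  fixes d :: "'a::real_normed_vector"
  shows "r + ereal (a - (\<bar>\<kappa>\<bar> + 1) / 2 * (norm d)\<^sup>2) \<le> r + ereal (a + \<kappa> / 2 * (norm d)\<^sup>2)"
proof -
  have "0 \<le> (\<kappa> / 2 + (\<bar>\<kappa>\<bar> + 1) / 2) * (norm d)\<^sup>2"
    using abs_ge_minus_self[of \<kappa>] by (intro mult_nonneg_nonneg) (auto simp: field_simps)
  then have "a - (\<bar>\<kappa>\<bar> + 1) / 2 * (norm d)\<^sup>2 \<le> a + \<kappa> / 2 * (norm d)\<^sup>2"
    unfolding distrib_right by linarith
  then show ?thesis by (intro add_left_mono) simp
qed

text \<open>
  The definition asks for a positive constant in the subtracted quadratic term, hence
  \<open>\<bar>\<kappa>\<bar> + 1\<close> in place of \<open>-\<kappa>\<close>.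
\<close>

lemma prox_subdiffI_quadratic:
  assumes x: "x \<in> eff_dom f"
    and minor: "\<And>y. f x + ereal (\<zeta> \<bullet> (y - x) + \<kappa> / 2 * (norm (y - x))\<^sup>2) \<le> f y"
  shows "\<zeta> \<in> prox_subdiff f x"
proof -
  have "f x + ereal (\<zeta> \<bullet> (y - x) - (\<bar>\<kappa>\<bar> + 1) / 2 * (norm (y - x))\<^sup>2) \<le> f y" for y
    using ereal_quadratic_weaken minor by (rule order_trans)
  then show ?thesis
    unfolding prox_subdiff_def using x
    by (auto intro!: exI[of _ "1::real"] exI[of _ "\<bar>\<kappa>\<bar> + 1"])
qed

lemma norm_convex_combination:
  fixes x y :: "'a::real_inner"
  assumes "u + v = 1"
  shows "(norm (u *\<^sub>R x + v *\<^sub>R y))\<^sup>2 = u * (norm x)\<^sup>2 + v * (norm y)\<^sup>2 - u * v * (norm (y - x))\<^sup>2"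
proof -
  have u: "u = 1 - v" using assms by simp
  show ?thesis
    unfolding u power2_norm_eq_inner
    by (simp add: inner_add_left inner_add_right inner_diff_left inner_diff_right inner_commute algebra_simps)
qed

lemma modulus_convexD:
  assumes g: "modulus_convex \<kappa> g" and x: "g x = ereal a" and y: "g y = ereal b"
    and uv: "0 < u" "0 < v" "u + v = 1"
  shows "g (u *\<^sub>R x + v *\<^sub>R y) \<le> ereal (u * a + v * b - \<kappa> / 2 * (u * v * (norm (y - x))\<^sup>2))"
proof -
  define w where "w = u *\<^sub>R x + v *\<^sub>R y"
  have "g w - ereal (\<kappa> / 2 * (norm w)\<^sup>2)
      \<le> ereal u * (g x - ereal (\<kappa> / 2 * (norm x)\<^sup>2)) + ereal v * (g y - ereal (\<kappa> / 2 * (norm y)\<^sup>2))"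
    using g uv unfolding modulus_convex_def ereal_convex_def w_def by blast
  then have "g w \<le> ereal (u * (a - \<kappa> / 2 * (norm x)\<^sup>2) + v * (b - \<kappa> / 2 * (norm y)\<^sup>2) + \<kappa> / 2 * (norm w)\<^sup>2)"
    unfolding x y by (cases "g w") auto
  also have "u * (a - \<kappa> / 2 * (norm x)\<^sup>2) + v * (b - \<kappa> / 2 * (norm y)\<^sup>2) + \<kappa> / 2 * (norm w)\<^sup>2
      = u * a + v * b - \<kappa> / 2 * (u * v * (norm (y - x))\<^sup>2)"
    unfolding w_def norm_convex_combination[OF uv(3)] by (simp add: algebra_simps)
  finally show ?thesis unfolding w_def .
qed

text \<open>
  Along the segment from \<open>x\<close> to \<open>y\<close> convexity bounds \<open>g\<close> from above and the local proximal inequality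
  from below; dividing by the segment parameter and letting it tend to zero removes the proximal
  constant and leaves the modulus of convexity.
\<close>

lemma modulus_convex_prox_subdiff_global:
  assumes g: "modulus_convex \<kappa> g" and \<zeta>: "\<zeta> \<in> prox_subdiff g x"
  shows "g x + ereal (\<zeta> \<bullet> (y - x) + \<kappa> / 2 * (norm (y - x))\<^sup>2) \<le> g y"
proof (cases "g y")
  case (real b)
  from \<zeta> obtain \<eta> \<sigma> where \<eta>: "0 < \<eta>" and dom: "g x < \<infinity>"
    and prox: "\<And>w. w \<in> ball x \<eta> \<Longrightarrow> g x + ereal (\<zeta> \<bullet> (w - x) - \<sigma> / 2 * (norm (w - x))\<^sup>2) \<le> g w"
    unfolding prox_subdiff_def eff_dom_def by blast
  obtain a where a: "g x = ereal a"
    using dom g unfolding modulus_convex_def by (cases "g x") auto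
  define d where "d = y - x"
  define N where "N = (norm d)\<^sup>2"
  define t0 where "t0 = min (1/2) (\<eta> / (norm d + 1))"
  have t0: "0 < t0" "t0 < 1"
    using \<eta> by (auto simp: t0_def divide_pos_pos add_nonneg_pos)
  have key: "\<zeta> \<bullet> d + \<kappa> / 2 * N - t * ((\<sigma> + \<kappa>) / 2 * N) \<le> b - a" if t: "0 < t" "t < t0" for t
  proof -
    define w where "w = (1 - t) *\<^sub>R x + t *\<^sub>R y"
    have wx: "w - x = t *\<^sub>R d" by (simp add: w_def d_def algebra_simps)
    have "t * norm d < \<eta>"
    proof -
      have "t * norm d \<le> t * (norm d + 1)" using t by simp
      also have "\<dots> < \<eta> / (norm d + 1) * (norm d + 1)"
        using t by (intro mult_strict_right_mono) (auto simp: t0_def add_nonneg_pos)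
      also have "\<dots> = \<eta>" by (simp add: add_nonneg_eq_0_iff)
      finally show ?thesis .
    qed
    then have "w \<in> ball x \<eta>"
      using wx t by (simp add: dist_norm norm_minus_commute)
    from prox[OF this] have "ereal (a + (t * (\<zeta> \<bullet> d) - \<sigma> / 2 * (t\<^sup>2 * N))) \<le> g w"
      unfolding wx a using t by (simp add: N_def power_mult_distrib)
    also have "\<dots> \<le> ereal ((1 - t) * a + t * b - \<kappa> / 2 * ((1 - t) * t * N))"
      unfolding w_def N_def d_def using t t0 by (intro modulus_convexD[OF g a real]) auto
    finally have "t * (\<zeta> \<bullet> d + \<kappa> / 2 * N - t * ((\<sigma> + \<kappa>) / 2 * N)) \<le> t * (b - a)"
      by (simp add: field_simps power2_eq_square)
    then show ?thesis using t by simp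
  qed
  have "((\<lambda>t. \<zeta> \<bullet> d + \<kappa> / 2 * N - t * ((\<sigma> + \<kappa>) / 2 * N)) \<longlongrightarrow> \<zeta> \<bullet> d + \<kappa> / 2 * N - 0 * ((\<sigma> + \<kappa>) / 2 * N))
      (at_right 0)"
    by (intro tendsto_intros)
  moreover have "\<forall>\<^sub>F t in at_right 0. \<zeta> \<bullet> d + \<kappa> / 2 * N - t * ((\<sigma> + \<kappa>) / 2 * N) \<le> b - a"
    using key t0(1) unfolding eventually_at_right_field by blast
  ultimately have "\<zeta> \<bullet> d + \<kappa> / 2 * N \<le> b - a"
    using tendsto_upperbound by force
  then show ?thesis by (simp add: a real N_def d_def)
qed (use g in \<open>auto simp: modulus_convex_def\<close>)

lemma modulus_convex_lim_subdiff_iff: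
  fixes g :: "'a::{real_inner, complete_space} \<Rightarrow> ereal"
  assumes g: "modulus_convex \<kappa> g"
  shows "\<zeta> \<in> lim_subdiff g x \<longleftrightarrow> x \<in> eff_dom g \<and>
    (\<forall>y. g x + ereal (\<zeta> \<bullet> (y - x) + \<kappa> / 2 * (norm (y - x))\<^sup>2) \<le> g y)"
proof
  assume "\<zeta> \<in> lim_subdiff g x"
  then obtain X Z where x: "x \<in> eff_dom g" and X: "X \<longlonglongrightarrow> x" and Z: "weak_tendsto Z \<zeta>"
    and gX: "(\<lambda>n. g (X n)) \<longlonglongrightarrow> g x" and prox: "\<And>n. Z n \<in> prox_subdiff g (X n)"
    unfolding lim_subdiff_def by blast
  have fin: "\<bar>g x\<bar> \<noteq> \<infinity>"
    using x g unfolding eff_dom_def modulus_convex_def by (cases "g x") auto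
  have "g x + ereal (\<zeta> \<bullet> (y - x) + \<kappa> / 2 * (norm (y - x))\<^sup>2) \<le> g y" for y
  proof -
    have "(\<lambda>n. Z n \<bullet> (y - X n) + \<kappa> / 2 * (norm (y - X n))\<^sup>2)
        \<longlonglongrightarrow> \<zeta> \<bullet> (y - x) + \<kappa> / 2 * (norm (y - x))\<^sup>2"
      by (intro tendsto_intros X tendsto_inner_weak_strong[OF Z])
    then have "(\<lambda>n. g (X n) + ereal (Z n \<bullet> (y - X n) + \<kappa> / 2 * (norm (y - X n))\<^sup>2))
        \<longlonglongrightarrow> g x + ereal (\<zeta> \<bullet> (y - x) + \<kappa> / 2 * (norm (y - x))\<^sup>2)"
      using fin by (intro tendsto_add_ereal gX) (auto intro: tendsto_ereal)
    then show ?thesis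
      by (rule LIMSEQ_le_const2) (use modulus_convex_prox_subdiff_global[OF g prox] in blast)
  qed
  with x show "x \<in> eff_dom g \<and>
    (\<forall>y. g x + ereal (\<zeta> \<bullet> (y - x) + \<kappa> / 2 * (norm (y - x))\<^sup>2) \<le> g y)" by blast
next
  assume "x \<in> eff_dom g \<and> (\<forall>y. g x + ereal (\<zeta> \<bullet> (y - x) + \<kappa> / 2 * (norm (y - x))\<^sup>2) \<le> g y)"
  then have "\<zeta> \<in> prox_subdiff g x"
    by (intro prox_subdiffI_quadratic) auto
  then show "\<zeta> \<in> lim_subdiff g x"
    using prox_subdiff_subset_lim_subdiff by blast
qed

lemma modulus_convex_lim_subdiff_monotone:
  fixes g :: "'a::{real_inner, complete_space} \<Rightarrow> ereal"
  assumes g: "modulus_convex \<kappa> g" and y: "y \<in> lim_subdiff g x" and y': "y' \<in> lim_subdiff g x'"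
  shows "\<kappa> * (norm (x' - x))\<^sup>2 \<le> (x' - x) \<bullet> (y' - y)"
proof -
  note Y = y[unfolded modulus_convex_lim_subdiff_iff[OF g]]
    and Y' = y'[unfolded modulus_convex_lim_subdiff_iff[OF g]]
  obtain a a' where a: "g x = ereal a" and a': "g x' = ereal a'"
    using Y Y' g unfolding eff_dom_def modulus_convex_def
    by (metis less_ereal.simps(2) ereal_cases mem_Collect_eq order_less_irrefl)
  have "a + (y \<bullet> (x' - x) + \<kappa> / 2 * (norm (x' - x))\<^sup>2) \<le> a'"
    using Y a a' by (metis ereal_less_eq(3) plus_ereal.simps(1))
  moreover have "a' + (y' \<bullet> (x - x') + \<kappa> / 2 * (norm (x' - x))\<^sup>2) \<le> a"
    using Y' a a' by (metis ereal_less_eq(3) plus_ereal.simps(1) norm_minus_commute)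
  ultimately show ?thesis
    by (simp add: inner_diff_left inner_diff_right inner_commute algebra_simps)
qed

text \<open>
  For \<open>A\<close> in the graph of \<open>\<partial>f\<close> this is the smallest function for which every \<open>(x, y) \<in> A\<close>
  satisfies the \<open>\<kappa>\<close>-quadratic subgradient inequality with the value \<open>f x\<close> at \<open>x\<close>.
\<close>

definition quadratic_envelope ::
    "real \<Rightarrow> ('a \<Rightarrow> ereal) \<Rightarrow> ('a::real_inner \<times> 'a) set \<Rightarrow> 'a \<Rightarrow> ereal" where
  "quadratic_envelope \<kappa> f A w =
     (SUP (x, y)\<in>A. f x + ereal (y \<bullet> (w - x) + \<kappa> / 2 * (norm (w - x))\<^sup>2))"

lemma quadratic_envelope_upper:
  "(x, y) \<in> A \<Longrightarrow>
   f x + ereal (y \<bullet> (w - x) + \<kappa> / 2 * (norm (w - x))\<^sup>2) \<le> quadratic_envelope \<kappa> f A w"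
  unfolding quadratic_envelope_def by (rule SUP_upper2) auto

lemma quadratic_envelope_least:
  "(\<And>x y. (x, y) \<in> A \<Longrightarrow> f x + ereal (y \<bullet> (w - x) + \<kappa> / 2 * (norm (w - x))\<^sup>2) \<le> c) \<Longrightarrow>
   quadratic_envelope \<kappa> f A w \<le> c"
  unfolding quadratic_envelope_def by (rule SUP_least) auto

lemma modulus_convex_quadratic_envelope:
  assumes ne: "A \<noteq> {}" and fin: "\<And>x y. (x, y) \<in> A \<Longrightarrow> \<bar>f x\<bar> \<noteq> \<infinity>"
  shows "modulus_convex \<kappa> (quadratic_envelope \<kappa> f A)"
proof -
  let ?g = "quadratic_envelope \<kappa> f A"
  have not_minf: "?g w \<noteq> -\<infinity>" for w
  proof -
    obtain x y where xy: "(x, y) \<in> A" using ne by auto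
    then show ?thesis
      using quadratic_envelope_upper[OF xy, of f w \<kappa>] fin[OF xy] by (cases "f x") auto
  qed
  have "?g (u *\<^sub>R p + v *\<^sub>R q) - ereal (\<kappa> / 2 * (norm (u *\<^sub>R p + v *\<^sub>R q))\<^sup>2)
      \<le> ereal u * (?g p - ereal (\<kappa> / 2 * (norm p)\<^sup>2)) + ereal v * (?g q - ereal (\<kappa> / 2 * (norm q)\<^sup>2))"
    if uv: "0 < u" "0 < v" "u + v = 1" for p q u v
  proof (cases "?g p = \<infinity> \<or> ?g q = \<infinity>")
    case True
    then show ?thesis
      using uv not_minf[of p] not_minf[of q] by (cases "?g p"; cases "?g q") auto
  next
    case False
    then obtain a b where a: "?g p = ereal a" and b: "?g q = ereal b"
      using not_minf[of p] not_minf[of q] by (cases "?g p"; cases "?g q") auto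
    define w where "w = u *\<^sub>R p + v *\<^sub>R q"
    have le: "?g w \<le> ereal (u * a + v * b - \<kappa> / 2 * (u * v * (norm (q - p))\<^sup>2))"
    proof (rule quadratic_envelope_least)
      fix x y assume xy: "(x, y) \<in> A"
      obtain c where c: "f x = ereal c" using fin[OF xy] by (cases "f x") auto
      have wx: "w - x = u *\<^sub>R (p - x) + v *\<^sub>R (q - x)"
        using uv(3) by (simp add: w_def algebra_simps scaleR_add_left[symmetric])
      have 1: "c + (y \<bullet> (p - x) + \<kappa> / 2 * (norm (p - x))\<^sup>2) \<le> a"
        using quadratic_envelope_upper[OF xy, of f p \<kappa>] by (simp add: a c)
      have 2: "c + (y \<bullet> (q - x) + \<kappa> / 2 * (norm (q - x))\<^sup>2) \<le> b"
        using quadratic_envelope_upper[OF xy, of f q \<kappa>] by (simp add: b c)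
      have "c + (y \<bullet> (w - x) + \<kappa> / 2 * (norm (w - x))\<^sup>2) =
          (u + v) * c + u * (y \<bullet> (p - x)) + v * (y \<bullet> (q - x))
          + \<kappa> / 2 * (u * (norm (p - x))\<^sup>2 + v * (norm (q - x))\<^sup>2 - u * v * (norm (q - p))\<^sup>2)"
        unfolding wx norm_convex_combination[OF uv(3)] using uv(3)
        by (simp add: inner_add_right)
      also have "\<dots> = u * (c + (y \<bullet> (p - x) + \<kappa> / 2 * (norm (p - x))\<^sup>2))
          + v * (c + (y \<bullet> (q - x) + \<kappa> / 2 * (norm (q - x))\<^sup>2)) - \<kappa> / 2 * (u * v * (norm (q - p))\<^sup>2)"
        by (simp add: algebra_simps)
      also have "\<dots> \<le> u * a + v * b - \<kappa> / 2 * (u * v * (norm (q - p))\<^sup>2)"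
        using 1 2 uv by (intro diff_right_mono add_mono mult_left_mono) auto
      finally show "f x + ereal (y \<bullet> (w - x) + \<kappa> / 2 * (norm (w - x))\<^sup>2)
          \<le> ereal (u * a + v * b - \<kappa> / 2 * (u * v * (norm (q - p))\<^sup>2))"
        by (simp add: c)
    qed
    then obtain e where e: "?g w = ereal e"
      using not_minf[of w] by (cases "?g w") auto
    have "e - \<kappa> / 2 * (norm w)\<^sup>2 \<le> u * (a - \<kappa> / 2 * (norm p)\<^sup>2) + v * (b - \<kappa> / 2 * (norm q)\<^sup>2)"
      using le unfolding e unfolding w_def norm_convex_combination[OF uv(3)] by (simp add: algebra_simps)
    then show ?thesis
      unfolding w_def[symmetric] a b e by simp
  qed
  then show ?thesis
    unfolding modulus_convex_def ereal_convex_def using not_minf by blast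
qed

lemma lsc_quadratic_envelope:
  assumes fin: "\<And>x y. (x, y) \<in> A \<Longrightarrow> \<bar>f x\<bar> \<noteq> \<infinity>"
  shows "lsc_fun (quadratic_envelope \<kappa> f A)"
  unfolding lsc_fun_def
proof (intro allI quadratic_envelope_least)
  fix w x y assume xy: "(x, y) \<in> A"
  obtain c where c: "f x = ereal c" using fin[OF xy] by (cases "f x") auto
  define q where "q v = f x + ereal (y \<bullet> (v - x) + \<kappa> / 2 * (norm (v - x))\<^sup>2)" for v
  have "(q \<longlongrightarrow> q w) (at w)"
    unfolding q_def c by (auto intro!: tendsto_intros)
  then have "q w \<le> Liminf (at w) (quadratic_envelope \<kappa> f A)"
    unfolding le_Liminf_iff
  proof (intro allI impI)
    fix b assume "(q \<longlongrightarrow> q w) (at w)" "b < q w"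
    then have "\<forall>\<^sub>F v in at w. b < q v" by (rule order_tendstoD)
    then show "\<forall>\<^sub>F v in at w. b < quadratic_envelope \<kappa> f A v"
      by eventually_elim (use quadratic_envelope_upper[OF xy] in \<open>auto simp: q_def intro: less_le_trans\<close>)
  qed
  then show "f x + ereal (y \<bullet> (w - x) + \<kappa> / 2 * (norm (w - x))\<^sup>2)
      \<le> Liminf (at w) (quadratic_envelope \<kappa> f A)"
    by (simp add: q_def)
qed

section \<open>The resolvent of a localized subdifferential\<close>

text \<open>
  For \<open>\<gamma> \<sigma> \<le> 1/2\<close> the quadratic \<open>\<parallel>x' - z\<parallel>\<^sup>2/(2\<gamma>)\<close> with \<open>z = x + \<gamma> y\<close> dominates the concave term of the
  prox-regularity inequality, so that \<open>x\<close> minimizes \<open>f + \<parallel>\<cdot> - z\<parallel>\<^sup>2/(2\<gamma>)\<close> for every pair \<open>(x, y)\<close> that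
  satisfies this inequality.
\<close>

lemma prox_regular_tilt_minimum:
  fixes x :: "'a::real_inner"
  assumes \<gamma>: "0 < \<gamma>" "\<gamma> * \<sigma> \<le> 1 / 2"
  shows "((norm (x - (x + \<gamma> *\<^sub>R y)))\<^sup>2 - (norm (x' - (x + \<gamma> *\<^sub>R y)))\<^sup>2) / (2 * \<gamma>)
    \<le> y \<bullet> (x' - x) - \<sigma> / 2 * (norm (x' - x))\<^sup>2"
proof -
  define d where "d = x' - x"
  have e: "x - (x + \<gamma> *\<^sub>R y) = - (\<gamma> *\<^sub>R y)" "x' - (x + \<gamma> *\<^sub>R y) = d - \<gamma> *\<^sub>R y"
    by (simp_all add: d_def)
  have "(norm (- (\<gamma> *\<^sub>R y)))\<^sup>2 - (norm (d - \<gamma> *\<^sub>R y))\<^sup>2 = 2 * \<gamma> * (y \<bullet> d) - (norm d)\<^sup>2"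
    unfolding norm_minus_cancel power2_norm_eq_inner
    by (simp add: inner_diff_left inner_diff_right inner_commute algebra_simps)
  moreover have "\<gamma> * \<sigma> * (norm d)\<^sup>2 \<le> 1 * (norm d)\<^sup>2"
    using \<gamma> by (intro mult_right_mono) auto
  ultimately show ?thesis
    unfolding e d_def[symmetric] using \<gamma>(1) by (simp add: field_simps)
qed

text \<open>
  The set \<open>T\<close> is a localization of the graph of \<open>\<partial>f\<close> on which the prox-regularity inequality holds
  against all points of \<open>B\<close>, and \<open>Z\<close> is a convex set that \<open>I + \<gamma> T\<close> covers.  On \<open>Z\<close> the resolvent
  \<open>(I + \<gamma> T)\<^sup>-\<^sup>1\<close>, the Yosida regularization and the Moreau envelope are then single-valued, as in the
  convex case.  Keeping \<open>T\<close>, \<open>B\<close> and \<open>Z\<close> abstract separates these facts from the choice of radii.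
\<close>

locale resolvent_localization =
  fixes f :: "'a::{real_inner, complete_space} \<Rightarrow> ereal" and T :: "('a \<times> 'a) set"
    and B Z :: "'a set" and \<gamma> \<sigma> :: real
  assumes T_subdiff: "(x, y) \<in> T \<Longrightarrow> y \<in> lim_subdiff f x"
    and T_finite: "(x, y) \<in> T \<Longrightarrow> \<bar>f x\<bar> \<noteq> \<infinity>"
    and T_sub: "(x, y) \<in> T \<Longrightarrow> x \<in> B"
    and prox: "(x, y) \<in> T \<Longrightarrow> x' \<in> B \<Longrightarrow>
      f x + ereal (y \<bullet> (x' - x) - \<sigma> / 2 * (norm (x' - x))\<^sup>2) \<le> f x'"
    and \<gamma>: "0 < \<gamma>" "\<gamma> * \<sigma> \<le> 1 / 2"
    and Z: "convex Z"
    and surj: "z \<in> Z \<Longrightarrow> \<exists>(x, y)\<in>T. x + \<gamma> *\<^sub>R y = z"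
begin

definition fval :: "'a \<Rightarrow> real" where "fval x = real_of_ereal (f x)"

definition resolv :: "'a \<Rightarrow> 'a" where "resolv z = (SOME x. (x, (z - x) /\<^sub>R \<gamma>) \<in> T)"

definition yosida :: "'a \<Rightarrow> 'a" where "yosida z = (z - resolv z) /\<^sub>R \<gamma>"

definition moreau :: "'a \<Rightarrow> real" where "moreau z = fval (resolv z) + (norm (resolv z - z))\<^sup>2 / (2 * \<gamma>)"

lemma f_eq: "(x, y) \<in> T \<Longrightarrow> f x = ereal (fval x)"
  using T_finite by (simp add: fval_def ereal_real)

lemma prox_real:
  assumes "(x, y) \<in> T" "(x', y') \<in> T"
  shows "fval x + y \<bullet> (x' - x) - \<sigma> / 2 * (norm (x' - x))\<^sup>2 \<le> fval x'"
  using prox[OF assms(1) T_sub[OF assms(2)]] by (simp add: f_eq[OF assms(1)] f_eq[OF assms(2)])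

lemma resolv_yosida: "z \<in> Z \<Longrightarrow> (resolv z, yosida z) \<in> T" "resolv z + \<gamma> *\<^sub>R yosida z = z"
proof -
  assume "z \<in> Z"
  then obtain x y where "(x, y) \<in> T" "x + \<gamma> *\<^sub>R y = z" using surj by blast
  moreover then have "y = (z - x) /\<^sub>R \<gamma>" using \<gamma>(1) by auto
  ultimately show "(resolv z, yosida z) \<in> T"
    unfolding resolv_def yosida_def by (metis (mono_tags, lifting) someI)
next
  show "resolv z + \<gamma> *\<^sub>R yosida z = z" using \<gamma>(1) by (simp add: yosida_def)
qed

text \<open>
  Adding the prox-regularity inequalities of two pairs shows that \<open>T\<close> is \<open>-\<sigma>\<close>-monotone; as
  \<open>\<gamma> \<sigma> \<le> 1/2\<close>, the map \<open>I + \<gamma> T\<close> is \<open>1/2\<close>-strongly monotone.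
\<close>

lemma T_lipschitz:
  assumes T: "(x, y) \<in> T" "(x', y') \<in> T"
  shows "norm (x' - x) \<le> 2 * norm ((x' + \<gamma> *\<^sub>R y') - (x + \<gamma> *\<^sub>R y))"
proof -
  define d k where "d = x' - x" and "k = y' - y"
  have "- \<sigma> * (norm d)\<^sup>2 \<le> d \<bullet> k"
    using prox_real[OF T] prox_real[OF T(2,1)]
    by (simp add: d_def k_def inner_diff_left inner_diff_right inner_commute norm_minus_commute)
  then have "\<gamma> * (- \<sigma> * (norm d)\<^sup>2) \<le> \<gamma> * (d \<bullet> k)"
    using \<gamma>(1) by (intro mult_left_mono) auto
  moreover have "\<gamma> * \<sigma> * (norm d)\<^sup>2 \<le> 1 / 2 * (norm d)\<^sup>2"
    using \<gamma> by (intro mult_right_mono) auto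
  ultimately have "1 / 2 * (norm d)\<^sup>2 \<le> d \<bullet> (d + \<gamma> *\<^sub>R k)"
    by (simp add: inner_add_right dot_square_norm)
  also have "\<dots> \<le> norm d * norm (d + \<gamma> *\<^sub>R k)" by (rule norm_cauchy_schwarz)
  finally have "norm d * norm d \<le> norm d * (2 * norm (d + \<gamma> *\<^sub>R k))"
    by (simp add: power2_eq_square)
  then have bound: "norm d \<le> 2 * norm (d + \<gamma> *\<^sub>R k)"
    by (cases "d = 0") (auto simp: mult_le_cancel_left)
  have eq: "d + \<gamma> *\<^sub>R k = (x' + \<gamma> *\<^sub>R y') - (x + \<gamma> *\<^sub>R y)"
    by (simp add: d_def k_def algebra_simps)
  show ?thesis
    using bound unfolding eq unfolding d_def .
qed

lemma resolv_eq: "(x, y) \<in> T \<Longrightarrow> x + \<gamma> *\<^sub>R y \<in> Z \<Longrightarrow> resolv (x + \<gamma> *\<^sub>R y) = x"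
  using T_lipschitz[OF _ resolv_yosida(1), of x y "x + \<gamma> *\<^sub>R y"] by (simp add: resolv_yosida(2))

lemma resolv_lipschitz: "z \<in> Z \<Longrightarrow> z' \<in> Z \<Longrightarrow> norm (resolv z' - resolv z) \<le> 2 * norm (z' - z)"
  using T_lipschitz[OF resolv_yosida(1) resolv_yosida(1)] by (simp add: resolv_yosida(2))

text \<open>
  The value \<open>moreau z\<close> is attained at \<open>resolv z\<close> by definition; that it is the minimum of
  \<open>f + \<parallel>\<cdot> - z\<parallel>\<^sup>2/(2\<gamma>)\<close> over \<open>B\<close> is where prox-regularity enters.
\<close>

lemma moreau_le:
  assumes z: "z \<in> Z" and x': "x' \<in> B"
  shows "ereal (moreau z - (norm (x' - z))\<^sup>2 / (2 * \<gamma>)) \<le> f x'"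
proof -
  note PQ = resolv_yosida(1)[OF z]
  have "((norm (resolv z - z))\<^sup>2 - (norm (x' - z))\<^sup>2) / (2 * \<gamma>)
      \<le> yosida z \<bullet> (x' - resolv z) - \<sigma> / 2 * (norm (x' - resolv z))\<^sup>2"
    using prox_regular_tilt_minimum[OF \<gamma>, of "resolv z" "yosida z" x'] by (simp add: resolv_yosida(2))
  then have "ereal (moreau z - (norm (x' - z))\<^sup>2 / (2 * \<gamma>))
      \<le> f (resolv z) + ereal (yosida z \<bullet> (x' - resolv z) - \<sigma> / 2 * (norm (x' - resolv z))\<^sup>2)"
    by (simp add: f_eq[OF PQ] moreau_def diff_divide_distrib)
  also have "\<dots> \<le> f x'" by (rule prox[OF PQ x'])
  finally show ?thesis .
qed

text \<open>
  Insert \<open>resolv v\<close> as a competitor in the minimum that defines the envelope at \<open>w\<close>.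
\<close>

lemma moreau_upper:
  assumes v: "v \<in> Z" and w: "w \<in> Z"
  shows "moreau w \<le> moreau v + yosida v \<bullet> (w - v) + 1 / (2 * \<gamma>) * (norm (w - v))\<^sup>2"
proof -
  note PQ = resolv_yosida(1)[OF v]
  have "moreau w - (norm (resolv v - w))\<^sup>2 / (2 * \<gamma>) \<le> fval (resolv v)"
    using moreau_le[OF w T_sub[OF PQ]] by (simp add: f_eq[OF PQ])
  moreover have "(norm (resolv v - w))\<^sup>2 = (norm (resolv v - v))\<^sup>2 + 2 * \<gamma> * (yosida v \<bullet> (w - v)) + (norm (w - v))\<^sup>2"
  proof -
    have "resolv v - w = (resolv v - v) - (w - v)" by simp
    then have "(norm (resolv v - w))\<^sup>2 = (norm (resolv v - v))\<^sup>2 + 2 * ((v - resolv v) \<bullet> (w - v)) + (norm (w - v))\<^sup>2"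
      by (simp only: power2_norm_eq_inner inner_diff_left inner_diff_right inner_commute) simp
    moreover have "v - resolv v = \<gamma> *\<^sub>R yosida v"
      using \<gamma>(1) by (simp add: yosida_def)
    ultimately show ?thesis by simp
  qed
  ultimately show ?thesis
    using \<gamma>(1) by (simp add: moreau_def add_divide_distrib)
qed

text \<open>
  The attentive derivative only sees sequences along which the values of \<open>f\<close> converge.  On \<open>T\<close> this
  is automatic: the prox-regularity inequality in both directions squeezes the values.
\<close>

lemma f_resolv_tendsto:
  assumes z: "z \<in> Z" and X: "\<And>k. X k \<in> Z" "X \<longlonglongrightarrow> z"
  shows "(\<lambda>k. f (resolv (X k))) \<longlonglongrightarrow> f (resolv z)"
proof -
  have resolv: "(\<lambda>k. resolv (X k)) \<longlonglongrightarrow> resolv z"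
  proof (rule LIM_zero_cancel, rule Lim_null_comparison[OF always_eventually], rule allI)
    show "norm (resolv (X k) - resolv z) \<le> 2 * norm (X k - z)" for k
      by (rule resolv_lipschitz[OF z X(1)])
    show "(\<lambda>k. 2 * norm (X k - z)) \<longlonglongrightarrow> 0"
      using X(2) by (intro tendsto_mult_right_zero tendsto_norm_zero) (simp add: LIM_zero_iff)
  qed
  then have yosida: "(\<lambda>k. yosida (X k)) \<longlonglongrightarrow> yosida z"
    unfolding yosida_def by (intro tendsto_intros X(2))
  define lower where
    "lower k = fval (resolv z) + yosida z \<bullet> (resolv (X k) - resolv z) - \<sigma> / 2 * (norm (resolv (X k) - resolv z))\<^sup>2" for k
  define upper where
    "upper k = fval (resolv z) - yosida (X k) \<bullet> (resolv z - resolv (X k)) + \<sigma> / 2 * (norm (resolv z - resolv (X k)))\<^sup>2" for k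
  have "(\<lambda>k. fval (resolv (X k))) \<longlonglongrightarrow> fval (resolv z)"
  proof (rule tendsto_sandwich[OF always_eventually always_eventually])
    show "\<forall>k. lower k \<le> fval (resolv (X k))"
      unfolding lower_def using prox_real[OF resolv_yosida(1)[OF z] resolv_yosida(1)[OF X(1)]] by blast
    show "\<forall>k. fval (resolv (X k)) \<le> upper k"
      unfolding upper_def using prox_real[OF resolv_yosida(1)[OF X(1)] resolv_yosida(1)[OF z]] by (simp add: algebra_simps)
    have "lower \<longlonglongrightarrow> fval (resolv z) + yosida z \<bullet> (resolv z - resolv z) - \<sigma> / 2 * (norm (resolv z - resolv z))\<^sup>2"
      unfolding lower_def by (intro tendsto_intros resolv)
    then show "lower \<longlonglongrightarrow> fval (resolv z)" by simp
    have "upper \<longlonglongrightarrow> fval (resolv z) - yosida z \<bullet> (resolv z - resolv z) + \<sigma> / 2 * (norm (resolv z - resolv z))\<^sup>2"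
      unfolding upper_def by (intro tendsto_intros resolv yosida)
    then show "upper \<longlonglongrightarrow> fval (resolv z)" by simp
  qed
  then show ?thesis
    using f_eq[OF resolv_yosida(1)[OF z]] f_eq[OF resolv_yosida(1)[OF X(1)]] by simp
qed

context
  fixes \<kappa> :: real
  assumes ldef: "\<And>x y u v. (x, y) \<in> T \<Longrightarrow> v \<in> attentive_deriv f x y u \<Longrightarrow> \<kappa> * (norm u)\<^sup>2 \<le> u \<bullet> v"
    and c: "0 < 1 + \<gamma> * \<kappa>"
begin

text \<open>
  A limit \<open>u\<close> of difference quotients of the resolvent in the direction \<open>d\<close> comes with the limit
  \<open>(d - u)/\<gamma>\<close> of those of the Yosida regularization, and this pair belongs to the attentive
  derivative of \<open>\<partial>f\<close>.  Lower definiteness of the pair is the infinitesimal form of the claim.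
\<close>

lemma resolv_cocoercive:
  assumes "z1 \<in> Z" "z2 \<in> Z"
  shows "(1 + \<gamma> * \<kappa>) * (norm (resolv z2 - resolv z1))\<^sup>2 \<le> (resolv z2 - resolv z1) \<bullet> (z2 - z1)"
proof (rule cocoercive_if_directionally_cocoercive[OF Z assms resolv_lipschitz c])
  fix z d u and s :: "nat \<Rightarrow> real"
  assume z: "z \<in> Z" and s: "\<And>k. 0 < s k" "\<And>k. z + s k *\<^sub>R d \<in> Z" "s \<longlonglongrightarrow> 0"
    and u: "(\<lambda>k. (resolv (z + s k *\<^sub>R d) - resolv z) /\<^sub>R s k) \<longlonglongrightarrow> u"
  define uu where "uu k = (resolv (z + s k *\<^sub>R d) - resolv z) /\<^sub>R s k" for k
  define vv where "vv k = (d - uu k) /\<^sub>R \<gamma>" for k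
  have x: "resolv z + s k *\<^sub>R uu k = resolv (z + s k *\<^sub>R d)" for k
    using s(1)[of k] by (simp add: uu_def)
  have y: "yosida z + s k *\<^sub>R vv k = yosida (z + s k *\<^sub>R d)" for k
  proof -
    have "yosida z + s k *\<^sub>R vv k = ((z + s k *\<^sub>R d) - (resolv z + s k *\<^sub>R uu k)) /\<^sub>R \<gamma>"
      by (simp add: yosida_def vv_def algebra_simps)
    then show ?thesis by (simp add: x yosida_def)
  qed
  have zs: "(\<lambda>k. z + s k *\<^sub>R d) \<longlonglongrightarrow> z"
    using tendsto_add[OF tendsto_const tendsto_scaleR[OF s(3) tendsto_const], of z d] by simp
  have "(d - u) /\<^sub>R \<gamma> \<in> attentive_deriv f (resolv z) (yosida z) u"
    unfolding attentive_deriv_def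
  proof (intro CollectI exI conjI allI)
    show "0 < s k" for k by fact
    show "s \<longlonglongrightarrow> 0" by fact
    show uu: "uu \<longlonglongrightarrow> u" using u unfolding uu_def .
    show "vv \<longlonglongrightarrow> (d - u) /\<^sub>R \<gamma>" unfolding vv_def by (intro tendsto_intros uu)
    show "yosida z + s k *\<^sub>R vv k \<in> lim_subdiff f (resolv z + s k *\<^sub>R uu k)" for k
      unfolding x y by (rule T_subdiff[OF resolv_yosida(1)[OF s(2)]])
    show "(\<lambda>k. f (resolv z + s k *\<^sub>R uu k)) \<longlonglongrightarrow> f (resolv z)"
      unfolding x by (rule f_resolv_tendsto[OF z s(2) zs])
  qed
  then have "\<gamma> * (\<kappa> * (norm u)\<^sup>2) \<le> \<gamma> * (u \<bullet> ((d - u) /\<^sub>R \<gamma>))"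
    using \<gamma>(1) by (intro mult_left_mono ldef[OF resolv_yosida(1)[OF z]]) auto
  moreover have "\<gamma> * (u \<bullet> ((d - u) /\<^sub>R \<gamma>)) = u \<bullet> d - (norm u)\<^sup>2"
    using \<gamma>(1) by (simp add: inner_diff_right power2_norm_eq_inner)
  ultimately show "(1 + \<gamma> * \<kappa>) * (norm u)\<^sup>2 \<le> u \<bullet> d"
    by (simp add: algebra_simps)
qed

text \<open>
  Cocoercivity and the Cauchy-Schwarz inequality bound \<open>\<langle>P w - P v, w - v\<rangle>\<close> above by
  \<open>\<parallel>w - v\<parallel>\<^sup>2/(1 + \<gamma>\<kappa>)\<close>, where \<open>P\<close> is the resolvent.
\<close>

lemma yosida_strongly_monotone:
  assumes v: "v \<in> Z" and w: "w \<in> Z"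
  shows "\<kappa> / (1 + \<gamma> * \<kappa>) * (norm (w - v))\<^sup>2 \<le> (yosida w - yosida v) \<bullet> (w - v)"
proof -
  define c where "c = 1 + \<gamma> * \<kappa>"
  define p d where "p = resolv w - resolv v" and "d = w - v"
  have c0: "0 < c" using c by (simp add: c_def)
  have co: "c * (norm p)\<^sup>2 \<le> p \<bullet> d"
    using resolv_cocoercive[OF v w] by (simp add: c_def p_def d_def)
  have pd: "p \<bullet> d \<le> norm p * norm d" by (rule norm_cauchy_schwarz)
  have "norm p * (c * norm p) \<le> norm p * norm d"
    using co pd by (simp add: power2_eq_square mult_ac)
  then have "c * norm p \<le> norm d"
    by (cases "p = 0") (auto simp: mult_le_cancel_left)
  then have "c * norm p * norm d \<le> norm d * norm d"
    by (rule mult_right_mono) simp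
  moreover have "c * (p \<bullet> d) \<le> c * (norm p * norm d)"
    using pd c0 by (intro mult_left_mono) auto
  ultimately have "c * (p \<bullet> d) \<le> (norm d)\<^sup>2"
    by (simp add: power2_eq_square mult_ac)
  then have "p \<bullet> d \<le> (norm d)\<^sup>2 / c" using c0 by (simp add: field_simps)
  then have "((norm d)\<^sup>2 - (norm d)\<^sup>2 / c) / \<gamma> \<le> ((norm d)\<^sup>2 - p \<bullet> d) / \<gamma>"
    using \<gamma>(1) by (intro divide_right_mono) auto
  also have "((norm d)\<^sup>2 - (norm d)\<^sup>2 / c) / \<gamma> = \<kappa> / c * (norm d)\<^sup>2"
  proof -
    have \<kappa>: "\<kappa> = (c - 1) / \<gamma>" using \<gamma>(1) by (simp add: c_def)
    show ?thesis unfolding \<kappa> using c0 \<gamma>(1) by (simp add: field_simps)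
  qed
  also have "((norm d)\<^sup>2 - p \<bullet> d) / \<gamma> = (yosida w - yosida v) \<bullet> d"
  proof -
    have "yosida w - yosida v = (d - p) /\<^sub>R \<gamma>"
      by (simp add: yosida_def p_def d_def algebra_simps)
    then show ?thesis
      by (simp add: power2_norm_eq_inner inner_diff_left divide_inverse mult.commute)
  qed
  finally show ?thesis by (simp add: c_def d_def)
qed

text \<open>
  Combine \<open>f x' \<ge> moreau w - \<parallel>x' - w\<parallel>\<^sup>2/(2\<gamma>)\<close> with the quadratic minorant of the envelope at
  \<open>v = x + \<gamma> y\<close>.  The best choice of \<open>w\<close> is \<open>x' + \<gamma> (y + \<kappa> (x' - x))\<close>, where the minorant to be
  proved has the gradient \<open>y + \<kappa> (x' - x)\<close> at \<open>x'\<close>; with it the quadratic terms combine exactly to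
  modulus \<open>\<kappa>\<close>.
\<close>

lemma lower_definite_imp_quadratic_minorant:
  assumes xy: "(x, y) \<in> T" and z: "x + \<gamma> *\<^sub>R y \<in> Z" and x': "x' \<in> B"
    and z': "x + \<gamma> *\<^sub>R y + (1 + \<gamma> * \<kappa>) *\<^sub>R (x' - x) \<in> Z"
  shows "f x + ereal (y \<bullet> (x' - x) + \<kappa> / 2 * (norm (x' - x))\<^sup>2) \<le> f x'"
proof -
  define c d where "c = 1 + \<gamma> * \<kappa>" and "d = x' - x"
  define v w where "v = x + \<gamma> *\<^sub>R y" and "w = v + c *\<^sub>R d"
  have vZ: "v \<in> Z" and wZ: "w \<in> Z"
    using z z' by (auto simp: v_def w_def c_def d_def)
  have c0: "c > 0" using c by (simp add: c_def)
  have Pv: "resolv v = x" using resolv_eq[OF xy z] by (simp add: v_def)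
  have Qv: "yosida v = y" using \<gamma>(1) by (simp add: yosida_def Pv) (simp add: v_def)
  have ev: "moreau v = fval x + \<gamma> / 2 * (norm y)\<^sup>2"
    using \<gamma>(1) by (simp add: moreau_def Pv) (simp add: v_def power_mult_distrib power2_eq_square)
  have "moreau v + yosida v \<bullet> (w - v) + \<kappa> / c / 2 * (norm (w - v))\<^sup>2 \<le> moreau w"
    unfolding c_def
    by (rule strongly_monotone_gradient_imp_quadratic_minorant[OF Z vZ wZ moreau_upper yosida_strongly_monotone])
  moreover have "\<kappa> / c / 2 * (norm (w - v))\<^sup>2 = \<kappa> * c / 2 * (norm d)\<^sup>2"
    using c0 by (simp add: w_def power_mult_distrib power2_eq_square)
  moreover have "x' - w = - (\<gamma> *\<^sub>R (y + \<kappa> *\<^sub>R d))"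
    by (simp add: w_def v_def c_def d_def algebra_simps)
  then have "(norm (x' - w))\<^sup>2 / (2 * \<gamma>) = \<gamma> / 2 * (norm (y + \<kappa> *\<^sub>R d))\<^sup>2"
    using \<gamma>(1) by (simp add: power_mult_distrib power2_eq_square)
  moreover have expand: "(norm (y + \<kappa> *\<^sub>R d))\<^sup>2 = (norm y)\<^sup>2 + 2 * \<kappa> * (y \<bullet> d) + \<kappa>\<^sup>2 * (norm d)\<^sup>2"
    unfolding power2_norm_eq_inner
    by (simp add: inner_add_left inner_add_right inner_commute algebra_simps power2_eq_square)
  moreover have "yosida v \<bullet> (w - v) = c * (y \<bullet> d)"
    by (simp add: Qv w_def)
  moreover have "\<gamma> / 2 * (norm y)\<^sup>2 + c * (y \<bullet> d) + \<kappa> * c / 2 * (norm d)\<^sup>2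
      - \<gamma> / 2 * ((norm y)\<^sup>2 + 2 * \<kappa> * (y \<bullet> d) + \<kappa>\<^sup>2 * (norm d)\<^sup>2) = y \<bullet> d + \<kappa> / 2 * (norm d)\<^sup>2"
    unfolding c_def by (simp add: algebra_simps power2_eq_square[of \<kappa>] add_divide_distrib)
  ultimately have "fval x + (y \<bullet> d + \<kappa> / 2 * (norm d)\<^sup>2) \<le> moreau w - (norm (x' - w))\<^sup>2 / (2 * \<gamma>)"
    using ev unfolding expand by linarith
  then have "f x + ereal (y \<bullet> d + \<kappa> / 2 * (norm d)\<^sup>2) \<le> ereal (moreau w - (norm (x' - w))\<^sup>2 / (2 * \<gamma>))"
    by (simp add: f_eq[OF xy])
  also have "\<dots> \<le> f x'" by (rule moreau_le[OF wZ x'])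
  finally show ?thesis by (simp add: d_def)
qed

end

end

lemma norm_diff_square:
  fixes d u :: "'a::real_inner"
  shows "(norm (d - u))\<^sup>2 - (norm (- u))\<^sup>2 = (norm d)\<^sup>2 - 2 * (d \<bullet> u)"
  unfolding norm_minus_cancel power2_norm_eq_inner
  by (simp add: inner_diff_left inner_diff_right inner_commute)

text \<open>
  Minimize \<open>f + \<parallel>\<cdot> - z\<parallel>\<^sup>2/(2\<gamma>)\<close> over a closed ball around \<open>xbar\<close>.  The prox-regularity inequality at
  \<open>(xbar, ybar)\<close> forces every minimizer to lie within four times the distance of \<open>z\<close> to
  \<open>xbar + \<gamma> ybar\<close>, hence in the interior of the ball, where \<open>y = (z - x)/\<gamma>\<close> is a proximal
  subgradient.  The estimates keep \<open>x\<close>, \<open>y\<close> and \<open>f x\<close> within a prescribed distance of the reference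
  values, since the attentive localization requires all three.
\<close>

lemma ex_local_resolvent:
  fixes f :: "'a::{real_inner, complete_space} \<Rightarrow> ereal"
  assumes fx: "f xbar = ereal b" and not_minf: "\<And>x. f x \<noteq> -\<infinity>"
    and r: "0 < r" and lsc: "\<And>x. x \<in> ball xbar r \<Longrightarrow> seq_weakly_lsc_at f x"
    and minor: "\<And>x. x \<in> ball xbar r \<Longrightarrow>
      f xbar + ereal (ybar \<bullet> (x - xbar) - \<sigma> / 2 * (norm (x - xbar))\<^sup>2) \<le> f x"
    and \<gamma>: "0 < \<gamma>" "\<gamma> * \<sigma> \<le> 1 / 2" and \<sigma>: "0 < \<sigma>" and \<eta>: "0 < \<eta>"
  shows "\<exists>\<rho>>0. \<forall>z\<in>ball (xbar + \<gamma> *\<^sub>R ybar) \<rho>. \<exists>x y. x \<in> ball xbar \<eta> \<and> y \<in> ball ybar \<eta> \<and>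
    \<bar>f x - f xbar\<bar> < ereal \<eta> \<and> y \<in> lim_subdiff f x \<and> x + \<gamma> *\<^sub>R y = z"
proof -
  define R where "R = r / 2"
  have R: "0 < R" "cball xbar R \<subseteq> ball xbar r" using r by (auto simp: R_def)
  \<comment> \<open>\<open>K\<close> is a Lipschitz constant for the deviation of \<open>f x\<close> from \<open>f xbar\<close> in terms of \<open>w\<close> below\<close>
  define K where "K = 4 * norm ybar + 8 * \<sigma> + 4 / \<gamma>"
  have K: "0 < K" using \<sigma> \<gamma> by (simp add: K_def add_nonneg_pos add_pos_pos)
  define \<rho> where "\<rho> = Min {1, R / 4, \<eta> / 4, \<gamma> * \<eta> / 5, \<eta> / K}"
  have \<rho>: "0 < \<rho>" using R \<eta> \<gamma> K by (simp add: \<rho>_def)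
  have \<rho>_le: "\<rho> \<le> 1" "\<rho> \<le> R / 4" "\<rho> \<le> \<eta> / 4" "\<rho> \<le> \<gamma> * \<eta> / 5" "\<rho> \<le> \<eta> / K"
    unfolding \<rho>_def by (rule Min_le; simp)+
  have "\<exists>x y. x \<in> ball xbar \<eta> \<and> y \<in> ball ybar \<eta> \<and>
    \<bar>f x - f xbar\<bar> < ereal \<eta> \<and> y \<in> lim_subdiff f x \<and> x + \<gamma> *\<^sub>R y = z"
    if z: "z \<in> ball (xbar + \<gamma> *\<^sub>R ybar) \<rho>" for z
  proof -
    define w where "w = z - (xbar + \<gamma> *\<^sub>R ybar)"
    have w: "norm w < \<rho>" using z by (simp add: w_def dist_norm norm_minus_commute)
    have "\<exists>x\<in>cball xbar R. \<forall>x'\<in>cball xbar R. f x + ereal (1 / (2 * \<gamma>) * (norm (x - z))\<^sup>2)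
        \<le> f x' + ereal (1 / (2 * \<gamma>) * (norm (x' - z))\<^sup>2)"
      using R lsc \<gamma>(1) by (intro ex_minimizer_on_cball) auto
    then obtain x where xB: "x \<in> cball xbar R" and min: "\<And>x'. x' \<in> cball xbar R \<Longrightarrow>
        f x + ereal (1 / (2 * \<gamma>) * (norm (x - z))\<^sup>2) \<le> f x' + ereal (1 / (2 * \<gamma>) * (norm (x' - z))\<^sup>2)"
      by blast
    define y where "y = (z - x) /\<^sub>R \<gamma>"
    define d where "d = x - xbar"
    have xy: "x + \<gamma> *\<^sub>R y = z" using \<gamma>(1) by (simp add: y_def)
    have "f x + ereal (1 / (2 * \<gamma>) * (norm (x - z))\<^sup>2) \<le> ereal b + ereal (1 / (2 * \<gamma>) * (norm (xbar - z))\<^sup>2)"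
      using min[of xbar] R by (simp add: fx)
    then obtain a where a: "f x = ereal a"
      using not_minf[of x] by (cases "f x") auto
    have up: "a + 1 / (2 * \<gamma>) * (norm (x - z))\<^sup>2 \<le> b + 1 / (2 * \<gamma>) * (norm (xbar - z))\<^sup>2"
      using min[of xbar] R by (simp add: fx a)
    have low: "b + (ybar \<bullet> d - \<sigma> / 2 * (norm d)\<^sup>2) \<le> a"
      using minor[of x] xB R by (auto simp: fx a d_def)
    have "x - z = d - (\<gamma> *\<^sub>R ybar + w)" "xbar - z = - (\<gamma> *\<^sub>R ybar + w)"
      by (simp_all add: d_def w_def)
    then have "(norm (x - z))\<^sup>2 - (norm (xbar - z))\<^sup>2 = (norm d)\<^sup>2 - 2 * (d \<bullet> (\<gamma> *\<^sub>R ybar + w))"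
      by (simp only: norm_diff_square)
    then have "1 / (2 * \<gamma>) * (norm (x - z))\<^sup>2 - 1 / (2 * \<gamma>) * (norm (xbar - z))\<^sup>2
        = 1 / (2 * \<gamma>) * ((norm d)\<^sup>2 - 2 * (d \<bullet> (\<gamma> *\<^sub>R ybar + w)))"
      by (simp only: right_diff_distrib[symmetric])
    also have "\<dots> = (norm d)\<^sup>2 / (2 * \<gamma>) - ybar \<bullet> d - d \<bullet> w / \<gamma>"
      using \<gamma>(1) by (simp add: inner_add_right inner_commute field_simps)
    finally have sq: "1 / (2 * \<gamma>) * (norm (x - z))\<^sup>2 - 1 / (2 * \<gamma>) * (norm (xbar - z))\<^sup>2
        = (norm d)\<^sup>2 / (2 * \<gamma>) - ybar \<bullet> d - d \<bullet> w / \<gamma>" .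
    have up': "a - b \<le> ybar \<bullet> d + d \<bullet> w / \<gamma> - (norm d)\<^sup>2 / (2 * \<gamma>)"
      using up sq by linarith
    have dw: "d \<bullet> w \<le> norm d * norm w" by (rule norm_cauchy_schwarz)
    have d_le: "norm d \<le> 4 * norm w"
    proof -
      have "(norm d)\<^sup>2 / (2 * \<gamma>) - \<sigma> / 2 * (norm d)\<^sup>2 \<le> d \<bullet> w / \<gamma>"
        using up' low by linarith
      then have "2 * \<gamma> * ((norm d)\<^sup>2 / (2 * \<gamma>) - \<sigma> / 2 * (norm d)\<^sup>2) \<le> 2 * \<gamma> * (d \<bullet> w / \<gamma>)"
        using \<gamma>(1) by (intro mult_left_mono) auto
      then have "(norm d)\<^sup>2 - \<gamma> * \<sigma> * (norm d)\<^sup>2 \<le> 2 * (d \<bullet> w)"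
        using \<gamma>(1) by (simp add: right_diff_distrib)
      moreover have "\<gamma> * \<sigma> * (norm d)\<^sup>2 \<le> 1 / 2 * (norm d)\<^sup>2"
        using \<gamma> by (intro mult_right_mono) auto
      ultimately have "norm d * norm d \<le> norm d * (4 * norm w)"
        using dw by (simp add: power2_eq_square)
      then show ?thesis
        by (cases "d = 0") (auto simp: mult_le_cancel_left)
    qed
    have d_lt: "norm d < 4 * \<rho>" using d_le w by linarith
    have xR: "norm d < R" using d_lt \<rho>_le by linarith
    have "x \<in> ball xbar \<eta>"
      using d_lt \<rho>_le by (simp add: d_def dist_norm norm_minus_commute)
    moreover have "y \<in> ball ybar \<eta>"
    proof -
      have "y - ybar = (w - d) /\<^sub>R \<gamma>"
        using \<gamma>(1) by (simp add: y_def w_def d_def algebra_simps)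
      then have "norm (y - ybar) = norm (w - d) / \<gamma>"
        using \<gamma>(1) by (simp add: divide_inverse mult.commute)
      also have "norm (w - d) < 5 * \<rho>"
        using norm_triangle_ineq4[of w d] w d_lt by linarith
      also have "5 * \<rho> / \<gamma> \<le> \<eta>" using \<rho>_le(4) \<gamma>(1) by (simp add: field_simps)
      finally show ?thesis
        using \<gamma>(1) by (simp add: dist_norm norm_minus_commute divide_strict_right_mono)
    qed
    moreover have "\<bar>f x - f xbar\<bar> < ereal \<eta>"
    proof -
      have w1: "norm w \<le> 1" using w \<rho>_le by linarith
      have "\<bar>ybar \<bullet> d\<bar> \<le> norm ybar * norm d" by (rule Cauchy_Schwarz_ineq2)
      also have "\<dots> \<le> norm ybar * (4 * norm w)" using d_le by (intro mult_left_mono) auto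
      finally have 1: "\<bar>ybar \<bullet> d\<bar> \<le> norm w * (4 * norm ybar)" by (simp add: mult_ac)
      have "(norm d)\<^sup>2 \<le> (4 * norm w)\<^sup>2" using d_le by (intro power_mono) auto
      also have "\<dots> = norm w * (16 * norm w)" by (simp add: power2_eq_square)
      also have "\<dots> \<le> norm w * (16 * 1)" using w1 by (intro mult_left_mono) auto
      finally have "\<sigma> / 2 * (norm d)\<^sup>2 \<le> \<sigma> / 2 * (norm w * (16 * 1))"
        using \<sigma> by (intro mult_left_mono) auto
      then have 2: "\<sigma> / 2 * (norm d)\<^sup>2 \<le> norm w * (8 * \<sigma>)" by (simp add: mult_ac)
      have "norm d * norm w \<le> 4 * norm w * 1"
        using d_le w1 by (intro mult_mono) auto
      then have "d \<bullet> w \<le> 4 * norm w * 1"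
        using dw by linarith
      then have "d \<bullet> w / \<gamma> \<le> 4 * norm w * 1 / \<gamma>"
        using \<gamma>(1) by (intro divide_right_mono) auto
      then have 3: "d \<bullet> w / \<gamma> \<le> norm w * (4 / \<gamma>)" by (simp add: mult_ac)
      have 4: "0 \<le> (norm d)\<^sup>2 / (2 * \<gamma>)" using \<gamma>(1) by simp
      have 5: "norm w * K = norm w * (4 * norm ybar) + norm w * (8 * \<sigma>) + norm w * (4 / \<gamma>)"
        by (simp add: K_def distrib_left)
      have 6: "0 \<le> norm w * (8 * \<sigma>)" "0 \<le> norm w * (4 / \<gamma>)" using \<sigma> \<gamma>(1) by auto
      have "\<bar>a - b\<bar> \<le> norm w * K"
        using 1 2 3 4 5 6 up' low by linarith
      also have "\<dots> < \<rho> * K" using w K by (intro mult_strict_right_mono) auto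
      also have "\<dots> \<le> \<eta>" using \<rho>_le(5) K by (simp add: field_simps)
      finally show ?thesis by (simp add: a fx)
    qed
    moreover have "y \<in> prox_subdiff f x"
      unfolding prox_subdiff_def
    proof (intro CollectI conjI exI ballI)
      show "x \<in> eff_dom f" by (simp add: eff_dom_def a)
      show "0 < R - norm d" using xR by simp
      show "0 < 1 / \<gamma>" using \<gamma>(1) by simp
      fix v assume "v \<in> ball x (R - norm d)"
      then have "norm (v - x) + norm d < R" by (simp add: dist_norm norm_minus_commute)
      then have "v \<in> cball xbar R"
        using norm_triangle_ineq[of "v - x" d] by (simp add: d_def dist_norm norm_minus_commute)
      note min_v = min[OF this]
      have "v - z = (v - x) - \<gamma> *\<^sub>R y" "x - z = - (\<gamma> *\<^sub>R y)"
        using xy by (auto simp: algebra_simps)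
      then have "(norm (v - z))\<^sup>2 - (norm (x - z))\<^sup>2 = (norm (v - x))\<^sup>2 - 2 * ((v - x) \<bullet> (\<gamma> *\<^sub>R y))"
        by (simp only: norm_diff_square)
      then have "(norm (x - z))\<^sup>2 - (norm (v - z))\<^sup>2 = 2 * \<gamma> * (y \<bullet> (v - x)) - (norm (v - x))\<^sup>2"
        by (simp add: inner_commute)
      then have "y \<bullet> (v - x) - 1 / \<gamma> / 2 * (norm (v - x))\<^sup>2
          = 1 / (2 * \<gamma>) * ((norm (x - z))\<^sup>2 - (norm (v - z))\<^sup>2)"
        using \<gamma>(1) by (simp add: field_simps)
      also have "\<dots> = 1 / (2 * \<gamma>) * (norm (x - z))\<^sup>2 - 1 / (2 * \<gamma>) * (norm (v - z))\<^sup>2"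
        by (rule right_diff_distrib)
      finally show "f x + ereal (y \<bullet> (v - x) - 1 / \<gamma> / 2 * (norm (v - x))\<^sup>2) \<le> f v"
        using min_v not_minf[of v] unfolding a by (cases "f v") auto
    qed
    ultimately show ?thesis
      using xy prox_subdiff_subset_lim_subdiff by blast
  qed
  then show ?thesis using \<rho> by blast
qed

section \<open>Variational convexity and the attentive graphical derivative\<close>

lemma open_Times_factors:
  assumes "open (U \<times> V)" "(x, y) \<in> U \<times> V"
  shows "open U" "open V"
proof -
  have "interior U \<times> interior V = U \<times> V"
    using assms(1) by (metis interior_Times interior_open)
  then have "interior U = U" "interior V = V"
    using assms(2) by (auto simp: times_eq_iff)
  then show "open U" "open V" by (metis open_interior)+
qed

text \<open>
  Near the reference point, attentive subgradients of \<open>f\<close> are subgradients of the \<open>\<kappa>\<close>-convex function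
  with the same value, so that they inherit its global subgradient inequality and its
  \<open>\<kappa>\<close>-monotonicity.
\<close>

lemma variationally_convex_imp_prox_regular_and_lower_definite:
  fixes f :: "'a::{real_inner, complete_space} \<Rightarrow> ereal"
  assumes fx: "f xbar = ereal b" and vc: "variationally_convex f xbar ybar \<kappa>"
  shows "prox_regular f xbar ybar"
    and "\<exists>\<epsilon>>0. \<exists>U V. (xbar, ybar) \<in> interior (U \<times> V) \<and>
        lower_definite_on f \<kappa> (attentive_nbhd f xbar U \<epsilon> \<times> V)"
proof -
  from vc have ybar: "ybar \<in> lim_subdiff f xbar" by (simp add: variationally_convex_def)
  from vc obtain U V fhat \<epsilon> where UV: "open (U \<times> V)" "(xbar, ybar) \<in> U \<times> V"
    and fhat: "modulus_convex \<kappa> fhat" and le: "\<And>x. x \<in> U \<Longrightarrow> fhat x \<le> f x" and \<epsilon>: "0 < \<epsilon>"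
    and gph_eq: "(attentive_nbhd f xbar U \<epsilon> \<times> V) \<inter> gph (lim_subdiff f)
        = (U \<times> V) \<inter> gph (lim_subdiff fhat)"
    and val_eq: "\<forall>(x, y) \<in> (attentive_nbhd f xbar U \<epsilon> \<times> V) \<inter> gph (lim_subdiff f). f x = fhat x"
    unfolding variationally_convex_def by auto
  have sub: "y \<in> lim_subdiff fhat x" and val: "f x = fhat x"
    if "x \<in> U" "f x < f xbar + ereal \<epsilon>" "y \<in> V" "y \<in> lim_subdiff f x" for x y
  proof -
    have "(x, y) \<in> (attentive_nbhd f xbar U \<epsilon> \<times> V) \<inter> gph (lim_subdiff f)"
      using that by (simp add: attentive_nbhd_def gph_def)
    then show "y \<in> lim_subdiff fhat x" "f x = fhat x"
      using gph_eq val_eq by (auto simp: gph_def)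
  qed
  note opn = open_Times_factors[OF UV]
  obtain r1 where r1: "0 < r1" "ball xbar r1 \<subseteq> U"
    using opn(1) UV(2) by (auto simp: open_contains_ball)
  obtain r2 where r2: "0 < r2" "ball ybar r2 \<subseteq> V"
    using opn(2) UV(2) by (auto simp: open_contains_ball)
  define \<delta> where "\<delta> = min \<epsilon> (min r1 r2)"
  have \<delta>: "0 < \<delta>" "\<delta> \<le> \<epsilon>" "ball xbar \<delta> \<subseteq> U" "ball ybar \<delta> \<subseteq> V"
    using \<epsilon> r1 r2 by (auto simp: \<delta>_def)
  show "prox_regular f xbar ybar"
    unfolding prox_regular_def
  proof (intro conjI ybar exI ballI impI)
    show "0 < \<delta>" by fact
    show "0 < \<bar>\<kappa>\<bar> + 1" by simp
    fix x x' y
    assume x: "x \<in> ball xbar \<delta>" and x': "x' \<in> ball xbar \<delta>" and y: "y \<in> ball ybar \<delta>"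
      and fy: "\<bar>f x - f xbar\<bar> < ereal \<delta> \<and> y \<in> lim_subdiff f x"
    have "f x < f xbar + ereal \<epsilon>"
      using fy \<delta>(2) by (cases "f x") (auto simp: fx)
    then have S: "y \<in> lim_subdiff fhat x" "f x = fhat x"
      using x y fy \<delta> by (auto intro!: sub val)
    have "f x + ereal (y \<bullet> (x' - x) - (\<bar>\<kappa>\<bar> + 1) / 2 * (norm (x' - x))\<^sup>2)
        \<le> f x + ereal (y \<bullet> (x' - x) + \<kappa> / 2 * (norm (x' - x))\<^sup>2)"
      by (rule ereal_quadratic_weaken)
    also have "\<dots> \<le> fhat x'"
      using S by (simp add: modulus_convex_lim_subdiff_iff[OF fhat])
    also have "\<dots> \<le> f x'" using le x' \<delta> by auto
    finally show "f x + ereal (y \<bullet> (x' - x) - (\<bar>\<kappa>\<bar> + 1) / 2 * (norm (x' - x))\<^sup>2) \<le> f x'" .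
  qed
  have "lower_definite_on f \<kappa> (attentive_nbhd f xbar U \<epsilon> \<times> V)"
    unfolding lower_definite_on_def
  proof (clarsimp simp: attentive_nbhd_def gph_def)
    fix x y u v
    assume x: "x \<in> U" "f x < f xbar + ereal \<epsilon>" and y: "y \<in> V" "y \<in> lim_subdiff f x"
      and "v \<in> attentive_deriv f x y u"
    then obtain s uu vv where s: "\<And>k. 0 < s k" "s \<longlonglongrightarrow> 0" and uu: "uu \<longlonglongrightarrow> u" and vv: "vv \<longlonglongrightarrow> v"
      and mem: "\<And>k. y + s k *\<^sub>R vv k \<in> lim_subdiff f (x + s k *\<^sub>R uu k)"
      and fs: "(\<lambda>k. f (x + s k *\<^sub>R uu k)) \<longlonglongrightarrow> f x"
      unfolding attentive_deriv_def by blast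
    have "(\<lambda>k. x + s k *\<^sub>R uu k) \<longlonglongrightarrow> x + 0 *\<^sub>R u" "(\<lambda>k. y + s k *\<^sub>R vv k) \<longlonglongrightarrow> y + 0 *\<^sub>R v"
      by (intro tendsto_intros s uu vv)+
    then have ev: "\<forall>\<^sub>F k in sequentially. x + s k *\<^sub>R uu k \<in> U" "\<forall>\<^sub>F k in sequentially. y + s k *\<^sub>R vv k \<in> V"
      using opn x(1) y(1) by (auto dest: topological_tendstoD)
    have "\<forall>\<^sub>F k in sequentially. f (x + s k *\<^sub>R uu k) < f xbar + ereal \<epsilon>"
      by (rule order_tendstoD(2)[OF fs x(2)])
    with ev have le: "\<forall>\<^sub>F k in sequentially. \<kappa> * (norm (uu k))\<^sup>2 \<le> uu k \<bullet> vv k"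
    proof eventually_elim
      case (elim k)
      have "y + s k *\<^sub>R vv k \<in> lim_subdiff fhat (x + s k *\<^sub>R uu k)"
        using elim mem by (intro sub) auto
      from modulus_convex_lim_subdiff_monotone[OF fhat sub[OF x y] this]
      have "(s k)\<^sup>2 * (\<kappa> * (norm (uu k))\<^sup>2) \<le> (s k)\<^sup>2 * (uu k \<bullet> vv k)"
        by (simp add: power_mult_distrib power2_eq_square mult_ac)
      then show ?case
        using s(1)[of k] by simp
    qed
    have lims: "(\<lambda>k. \<kappa> * (norm (uu k))\<^sup>2) \<longlonglongrightarrow> \<kappa> * (norm u)\<^sup>2" "(\<lambda>k. uu k \<bullet> vv k) \<longlonglongrightarrow> u \<bullet> v"
      by (intro tendsto_intros uu vv)+
    show "\<kappa> * (norm u)\<^sup>2 \<le> u \<bullet> v"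
      by (rule tendsto_le[OF sequentially_bot lims(2,1) le])
  qed
  moreover have "(xbar, ybar) \<in> interior (U \<times> V)"
    using UV by (simp add: interior_open)
  ultimately show "\<exists>\<epsilon>>0. \<exists>U V. (xbar, ybar) \<in> interior (U \<times> V) \<and>
      lower_definite_on f \<kappa> (attentive_nbhd f xbar U \<epsilon> \<times> V)"
    using \<epsilon> by blast
qed

text \<open>
  The \<open>\<kappa>\<close>-convex function is the quadratic envelope over a localization \<open>A\<close> of the graph.  Three radii
  occur: \<open>\<epsilon>\<close>, within which all hypotheses hold; \<open>\<delta>\<close>, within which the points that
  \<open>lower_definite_imp_quadratic_minorant\<close> evaluates stay in the domain of the resolvent; and \<open>r\<close>, for
  which the resolvent of points near the reference point lands in \<open>A\<close>.
\<close>

lemma prox_regular_and_lower_definite_imp_variationally_convex: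
  fixes f :: "'a::{real_inner, complete_space} \<Rightarrow> ereal"
  assumes fx: "f xbar = ereal b" and not_minf: "\<And>x. f x \<noteq> -\<infinity>"
    and lsc: "seq_weakly_lsc_around f xbar"
    and pr: "prox_regular f xbar ybar"
    and \<epsilon>1: "0 < \<epsilon>1" and UV: "(xbar, ybar) \<in> interior (U \<times> V)"
    and ldef: "lower_definite_on f \<kappa> (attentive_nbhd f xbar U \<epsilon>1 \<times> V)"
  shows "variationally_convex f xbar ybar \<kappa>"
proof -
  from pr have ybar: "ybar \<in> lim_subdiff f xbar" by (simp add: prox_regular_def)
  from pr obtain \<epsilon>0 \<sigma> where \<epsilon>0: "0 < \<epsilon>0" and \<sigma>: "0 < \<sigma>"
    and prox0: "\<And>x x' y. x \<in> ball xbar \<epsilon>0 \<Longrightarrow> x' \<in> ball xbar \<epsilon>0 \<Longrightarrow> y \<in> ball ybar \<epsilon>0 \<Longrightarrow>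
      \<bar>f x - f xbar\<bar> < ereal \<epsilon>0 \<Longrightarrow> y \<in> lim_subdiff f x \<Longrightarrow>
      f x + ereal (y \<bullet> (x' - x) - \<sigma> / 2 * (norm (x' - x))\<^sup>2) \<le> f x'"
    unfolding prox_regular_def by blast
  from lsc obtain r0 where r0: "0 < r0" "\<And>x. x \<in> ball xbar r0 \<Longrightarrow> seq_weakly_lsc_at f x"
    unfolding seq_weakly_lsc_around_def eventually_nhds_metric by (auto simp: dist_commute)
  obtain r1 where r1: "0 < r1" "ball xbar r1 \<subseteq> U"
    using UV by (auto simp: interior_Times mem_interior)
  obtain r2 where r2: "0 < r2" "ball ybar r2 \<subseteq> V"
    using UV by (auto simp: interior_Times mem_interior)
  define \<epsilon> where "\<epsilon> = Min {\<epsilon>0, \<epsilon>1, r0, r1, r2}"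
  have \<epsilon>: "0 < \<epsilon>" using \<epsilon>0 \<epsilon>1 r0(1) r1 r2 by (simp add: \<epsilon>_def)
  have \<epsilon>_le: "\<epsilon> \<le> \<epsilon>0" "\<epsilon> \<le> \<epsilon>1" "\<epsilon> \<le> r0" "\<epsilon> \<le> r1" "\<epsilon> \<le> r2"
    unfolding \<epsilon>_def by (rule Min_le; simp)+
  \<comment> \<open>small enough for single-valuedness of the resolvent and for \<open>1 + \<gamma> \<kappa> > 0\<close>\<close>
  define \<gamma> where "\<gamma> = 1 / (2 * (\<sigma> + \<bar>\<kappa>\<bar>))"
  have pos: "0 < \<sigma> + \<bar>\<kappa>\<bar>" using \<sigma> by simp
  have \<gamma>: "0 < \<gamma>" "\<gamma> * \<sigma> \<le> 1 / 2" "\<gamma> * \<bar>\<kappa>\<bar> \<le> 1 / 2"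
    using pos \<sigma> by (auto simp: \<gamma>_def field_simps)
  have "- (\<gamma> * \<kappa>) \<le> \<gamma> * \<bar>\<kappa>\<bar>"
    using mult_left_mono[OF abs_ge_minus_self[of \<kappa>], of \<gamma>] \<gamma>(1) by simp
  then have c: "0 < 1 + \<gamma> * \<kappa>"
    using \<gamma>(3) by linarith
  define T where "T = {(x, y). x \<in> ball xbar \<epsilon> \<and> y \<in> ball ybar \<epsilon> \<and>
      \<bar>f x - f xbar\<bar> < ereal \<epsilon> \<and> y \<in> lim_subdiff f x}"
  have prox: "f x + ereal (y \<bullet> (x' - x) - \<sigma> / 2 * (norm (x' - x))\<^sup>2) \<le> f x'"
    if "(x, y) \<in> T" "x' \<in> ball xbar \<epsilon>" for x y x'
  proof -
    have "\<bar>f x - f xbar\<bar> < ereal \<epsilon>0"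
      using that(1) \<epsilon>_le(1) by (auto simp: T_def intro: less_le_trans)
    then show ?thesis
      using that \<epsilon>_le(1) by (intro prox0) (auto simp: T_def)
  qed
  have barT: "(xbar, ybar) \<in> T"
    using \<epsilon> ybar by (simp add: T_def fx zero_ereal_def)
  have lsc': "seq_weakly_lsc_at f x" if "x \<in> ball xbar \<epsilon>" for x
    using that \<epsilon>_le(3) by (intro r0) auto
  define zbar where "zbar = xbar + \<gamma> *\<^sub>R ybar"
  note resolvent = ex_local_resolvent[OF fx not_minf \<epsilon> lsc' prox[OF barT] \<gamma>(1,2) \<sigma>, folded zbar_def]
  obtain \<rho> where \<rho>: "0 < \<rho>" and res: "\<And>z. z \<in> ball zbar \<rho> \<Longrightarrow> \<exists>x y. x \<in> ball xbar \<epsilon> \<and>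
      y \<in> ball ybar \<epsilon> \<and> \<bar>f x - f xbar\<bar> < ereal \<epsilon> \<and> y \<in> lim_subdiff f x \<and> x + \<gamma> *\<^sub>R y = z"
    using resolvent[OF _ _ \<epsilon>] by blast
  interpret resolvent_localization f T "ball xbar \<epsilon>" "ball zbar \<rho>" \<gamma> \<sigma>
  proof
    show "y \<in> lim_subdiff f x" "x \<in> ball xbar \<epsilon>" if "(x, y) \<in> T" for x y
      using that by (auto simp: T_def)
    show "\<bar>f x\<bar> \<noteq> \<infinity>" if "(x, y) \<in> T" for x y
      using that by (cases "f x") (auto simp: T_def fx)
    show "\<exists>(x, y)\<in>T. x + \<gamma> *\<^sub>R y = z" if "z \<in> ball zbar \<rho>" for z
      using res[OF that] by (auto simp: T_def)
    show "f x + ereal (y \<bullet> (x' - x) - \<sigma> / 2 * (norm (x' - x))\<^sup>2) \<le> f x'"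
      if "(x, y) \<in> T" "x' \<in> ball xbar \<epsilon>" for x y x'
      using prox[OF that] .
    show "0 < \<gamma>" "\<gamma> * \<sigma> \<le> 1 / 2" by fact+
    show "convex (ball zbar \<rho>)" by simp
  qed
  have ldefT: "\<kappa> * (norm u)\<^sup>2 \<le> u \<bullet> v" if "(x, y) \<in> T" "v \<in> attentive_deriv f x y u" for x y u v
  proof -
    have "f x < f xbar + ereal \<epsilon>1"
      using that(1) \<epsilon>_le(2) by (cases "f x") (auto simp: T_def fx)
    then have "(x, y) \<in> (attentive_nbhd f xbar U \<epsilon>1 \<times> V) \<inter> gph (lim_subdiff f)"
      using that(1) \<epsilon>_le r1 r2 by (auto simp: T_def attentive_nbhd_def gph_def)
    then show ?thesis
      using ldef that(2) unfolding lower_definite_on_def by blast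
  qed
  define K1 K2 where "K1 = 1 + \<gamma> + 2 * (1 + \<gamma> * \<kappa>)" and "K2 = norm ybar + \<sigma> + 1"
  have K: "0 < K1" "0 < K2" using \<gamma> c \<sigma> by (auto simp: K1_def K2_def add_nonneg_pos)
  define \<delta> where "\<delta> = Min {1, \<epsilon>, \<rho> / K1, \<epsilon> / K2}"
  have \<delta>: "0 < \<delta>" using \<epsilon> \<rho> K by (simp add: \<delta>_def)
  have "\<delta> \<le> \<rho> / K1" "\<delta> \<le> \<epsilon> / K2" and \<delta>_le: "\<delta> \<le> 1" "\<delta> \<le> \<epsilon>"
    unfolding \<delta>_def by (rule Min_le; simp)+
  then have \<delta>K: "\<delta> * K1 \<le> \<rho>" "\<delta> * K2 \<le> \<epsilon>" using K by (auto simp: field_simps)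
  have near_z: "norm (x + \<gamma> *\<^sub>R y - zbar) < (1 + \<gamma>) * r"
    if "x \<in> ball xbar r" "y \<in> ball ybar r" for x y r
  proof -
    have eq: "x + \<gamma> *\<^sub>R y - zbar = (x - xbar) + \<gamma> *\<^sub>R (y - ybar)"
      by (simp add: zbar_def algebra_simps)
    have "norm (x + \<gamma> *\<^sub>R y - zbar) \<le> norm (x - xbar) + \<gamma> * norm (y - ybar)"
      unfolding eq using norm_triangle_ineq[of "x - xbar" "\<gamma> *\<^sub>R (y - ybar)"] \<gamma>(1) by simp
    also have "\<dots> < r + \<gamma> * r"
      using that \<gamma>(1) by (intro add_strict_mono) (auto simp: dist_norm norm_minus_commute)
    finally show ?thesis by (simp add: algebra_simps)
  qed
  define A where "A = {(x, y). x \<in> ball xbar \<delta> \<and> y \<in> ball ybar \<delta> \<and>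
      f x < f xbar + ereal \<epsilon> \<and> y \<in> lim_subdiff f x}"
  \<comment> \<open>\<open>A\<close> bounds \<open>f x\<close> only from above; the bound from below comes from the
    prox-regularity inequality at the reference pair\<close>
  have AT: "(x, y) \<in> T" if xyA: "(x, y) \<in> A" for x y
  proof -
    have x: "norm (x - xbar) < \<delta>" "x \<in> ball xbar \<epsilon>"
      using xyA \<delta>_le by (auto simp: A_def dist_norm norm_minus_commute)
    have "f xbar + ereal (ybar \<bullet> (x - xbar) - \<sigma> / 2 * (norm (x - xbar))\<^sup>2) \<le> f x"
      using prox[OF barT x(2)] .
    moreover obtain a where a: "f x = ereal a"
      using xyA not_minf[of x] by (cases "f x") (auto simp: A_def fx)
    ultimately have low: "b + (ybar \<bullet> (x - xbar) - \<sigma> / 2 * (norm (x - xbar))\<^sup>2) \<le> a"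
      by (simp add: fx)
    define n where "n = norm (x - xbar)"
    have n: "0 \<le> n" "n < \<delta>" "n \<le> 1" using x(1) \<delta>_le(1) by (auto simp: n_def)
    have "- (ybar \<bullet> (x - xbar)) \<le> norm ybar * n"
      using Cauchy_Schwarz_ineq2[of ybar "x - xbar"] by (simp add: n_def)
    also have "\<dots> \<le> norm ybar * \<delta>" using n by (intro mult_left_mono) auto
    finally have 1: "- (ybar \<bullet> (x - xbar)) \<le> norm ybar * \<delta>" .
    have "n * n \<le> \<delta> * 1" using n by (intro mult_mono) auto
    then have "\<sigma> / 2 * (n * n) \<le> \<sigma> / 2 * (\<delta> * 1)" using \<sigma> by (intro mult_left_mono) auto
    moreover have "0 \<le> \<sigma> * \<delta>" using \<sigma> \<delta> by simp
    ultimately have 2: "\<sigma> / 2 * n\<^sup>2 \<le> \<sigma> * \<delta>" by (simp add: power2_eq_square)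
    have "\<delta> * K2 = norm ybar * \<delta> + \<sigma> * \<delta> + \<delta>" by (simp add: K2_def algebra_simps)
    then have "b - \<epsilon> < a"
      using low 1 2 \<delta>K(2) \<delta> unfolding n_def[symmetric] by linarith
    moreover have "a < b + \<epsilon>" using xyA by (simp add: A_def a fx)
    ultimately have "\<bar>f x - f xbar\<bar> < ereal \<epsilon>" by (simp add: a fx abs_less_iff)
    then show ?thesis
      using xyA \<delta>_le(2) by (auto simp: T_def A_def)
  qed
  have fin: "\<bar>f x\<bar> \<noteq> \<infinity>" if "(x, y) \<in> A" for x y
    using T_finite AT[OF that] .
  have minorant: "f x + ereal (y \<bullet> (x' - x) + \<kappa> / 2 * (norm (x' - x))\<^sup>2) \<le> f x'"
    if xy: "(x, y) \<in> A" and x': "x' \<in> ball xbar \<delta>" for x y x'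
  proof (rule lower_definite_imp_quadratic_minorant[OF ldefT c AT[OF xy]])
    have xb: "x \<in> ball xbar \<delta>" and yb: "y \<in> ball ybar \<delta>" using xy by (auto simp: A_def)
    note nz = near_z[OF xb yb]
    have K1': "\<delta> * K1 = (1 + \<gamma>) * \<delta> + (1 + \<gamma> * \<kappa>) * (2 * \<delta>)"
      by (simp add: K1_def algebra_simps)
    have "0 < (1 + \<gamma> * \<kappa>) * (2 * \<delta>)" using c \<delta> by simp
    then have "norm (x + \<gamma> *\<^sub>R y - zbar) < \<rho>" using nz K1' \<delta>K(1) by linarith
    then show "x + \<gamma> *\<^sub>R y \<in> ball zbar \<rho>" by (simp add: dist_norm norm_minus_commute)
    show "x' \<in> ball xbar \<epsilon>" using x' \<delta>_le(2) by auto
    have "norm (x' - x) < 2 * \<delta>"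
      using xb x' dist_triangle2[of x' x xbar] by (simp add: dist_norm norm_minus_commute)
    then have "norm ((1 + \<gamma> * \<kappa>) *\<^sub>R (x' - x)) \<le> (1 + \<gamma> * \<kappa>) * (2 * \<delta>)"
      using c by simp
    moreover have "norm (x + \<gamma> *\<^sub>R y + (1 + \<gamma> * \<kappa>) *\<^sub>R (x' - x) - zbar)
        \<le> norm (x + \<gamma> *\<^sub>R y - zbar) + norm ((1 + \<gamma> * \<kappa>) *\<^sub>R (x' - x))"
      using norm_triangle_ineq[of "x + \<gamma> *\<^sub>R y - zbar" "(1 + \<gamma> * \<kappa>) *\<^sub>R (x' - x)"]
      by (simp only: diff_add_eq)
    ultimately have "norm (x + \<gamma> *\<^sub>R y + (1 + \<gamma> * \<kappa>) *\<^sub>R (x' - x) - zbar) < \<rho>"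
      using nz K1' \<delta>K(1) by linarith
    then show "x + \<gamma> *\<^sub>R y + (1 + \<gamma> * \<kappa>) *\<^sub>R (x' - x) \<in> ball zbar \<rho>"
      by (simp only: mem_ball dist_norm norm_minus_commute)
  qed
  define fhat where "fhat = quadratic_envelope \<kappa> f A"
  have barA: "(xbar, ybar) \<in> A" using \<delta> \<epsilon> ybar by (simp add: A_def fx)
  have convex: "modulus_convex \<kappa> fhat"
    unfolding fhat_def using barA fin by (intro modulus_convex_quadratic_envelope) auto
  have lsc_hat: "lsc_fun fhat"
    unfolding fhat_def using fin by (rule lsc_quadratic_envelope)
  have fhat_le: "fhat x \<le> f x" if "x \<in> ball xbar \<delta>" for x
    unfolding fhat_def using minorant that by (intro quadratic_envelope_least)
  have fhat_eq: "fhat x = f x" if "(x, y) \<in> A" for x y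
  proof (rule antisym)
    show "fhat x \<le> f x" using that by (intro fhat_le) (auto simp: A_def)
    show "f x \<le> fhat x"
      using quadratic_envelope_upper[OF that, of f x \<kappa>] by (simp add: fhat_def)
  qed
  have sub_hat: "y \<in> lim_subdiff fhat x" if xy: "(x, y) \<in> A" for x y
    unfolding modulus_convex_lim_subdiff_iff[OF convex] fhat_eq[OF xy]
  proof
    show "x \<in> eff_dom fhat"
      using fin[OF xy] by (auto simp: eff_dom_def fhat_eq[OF xy])
  qed (use quadratic_envelope_upper[OF xy] in \<open>simp add: fhat_def\<close>)
  obtain \<rho>2 where \<rho>2: "0 < \<rho>2" and res2: "\<And>z. z \<in> ball zbar \<rho>2 \<Longrightarrow> \<exists>x y. x \<in> ball xbar \<delta> \<and>
      y \<in> ball ybar \<delta> \<and> \<bar>f x - f xbar\<bar> < ereal \<delta> \<and> y \<in> lim_subdiff f x \<and> x + \<gamma> *\<^sub>R y = z"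
    using resolvent[OF _ _ \<delta>] by blast
  define r where "r = min \<delta> (\<rho>2 / (1 + \<gamma>))"
  have r: "0 < r" "r \<le> \<delta>" "(1 + \<gamma>) * r \<le> \<rho>2"
  proof -
    have "(1 + \<gamma>) * r \<le> (1 + \<gamma>) * (\<rho>2 / (1 + \<gamma>))"
      using \<gamma>(1) by (intro mult_left_mono) (auto simp: r_def)
    then show "(1 + \<gamma>) * r \<le> \<rho>2" using \<gamma>(1) by simp
  qed (use \<delta> \<rho>2 \<gamma>(1) in \<open>auto simp: r_def\<close>)
  \<comment> \<open>a subgradient pair of \<open>fhat\<close> shares \<open>x + \<gamma> y\<close> with some pair of \<open>A\<close>, and then
    \<open>\<kappa>\<close>-monotonicity together with \<open>1 + \<gamma> \<kappa> > 0\<close> identifies the two\<close>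
  have recover: "(x, y) \<in> A" if x: "x \<in> ball xbar r" and y: "y \<in> ball ybar r" and yx: "y \<in> lim_subdiff fhat x" for x y
  proof -
    have "x + \<gamma> *\<^sub>R y \<in> ball zbar \<rho>2"
      using near_z[OF x y] r(3) by (simp add: dist_norm norm_minus_commute)
    from res2[OF this] obtain x1 y1 where 1: "x1 \<in> ball xbar \<delta>" "y1 \<in> ball ybar \<delta>"
        "\<bar>f x1 - f xbar\<bar> < ereal \<delta>" "y1 \<in> lim_subdiff f x1" and eq: "x1 + \<gamma> *\<^sub>R y1 = x + \<gamma> *\<^sub>R y"
      by blast
    have "f x1 < f xbar + ereal \<epsilon>"
      using 1(3) \<delta>_le(2) by (cases "f x1") (auto simp: fx)
    then have A1: "(x1, y1) \<in> A" using 1 by (simp add: A_def)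
    from modulus_convex_lim_subdiff_monotone[OF convex yx sub_hat[OF A1]]
    have mono: "\<kappa> * (norm (x1 - x))\<^sup>2 \<le> (x1 - x) \<bullet> (y1 - y)" .
    have d: "x1 - x = - (\<gamma> *\<^sub>R (y1 - y))" using eq by (simp add: algebra_simps)
    have "\<gamma> * (\<kappa> * (norm (x1 - x))\<^sup>2) \<le> \<gamma> * ((x1 - x) \<bullet> (y1 - y))"
      using mono \<gamma>(1) by (intro mult_left_mono) auto
    also have "\<dots> = (x1 - x) \<bullet> (\<gamma> *\<^sub>R (y1 - y))" by simp
    also have "\<gamma> *\<^sub>R (y1 - y) = - (x1 - x)" using d by simp
    also have "(x1 - x) \<bullet> - (x1 - x) = - (norm (x1 - x))\<^sup>2"
      by (simp only: inner_minus_right power2_norm_eq_inner)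
    finally have "(1 + \<gamma> * \<kappa>) * (norm (x1 - x))\<^sup>2 \<le> 0" by (simp add: algebra_simps)
    then have x1: "x1 = x" using c by (simp add: mult_le_0_iff)
    then have "y1 = y" using d \<gamma>(1) by simp
    with x1 show ?thesis using A1 by simp
  qed
  have inA: "(x, y) \<in> A"
    if "x \<in> ball xbar r" "y \<in> ball ybar r" "f x < f xbar + ereal \<epsilon>" "y \<in> lim_subdiff f x" for x y
    using that r(2) by (auto simp: A_def)
  show ?thesis
    unfolding variationally_convex_def
  proof (intro conjI ybar exI)
    show "open (ball xbar r \<times> ball ybar r)" by (intro open_Times) auto
    show "convex (ball xbar r \<times> ball ybar r)" by (intro convex_Times) auto
    show "(xbar, ybar) \<in> ball xbar r \<times> ball ybar r" using r(1) by simp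
    show "modulus_convex \<kappa> fhat" "lsc_fun fhat" "0 < \<epsilon>" by fact+
    show "\<forall>x\<in>ball xbar r. fhat x \<le> f x" using fhat_le r(2) by auto
    show "(attentive_nbhd f xbar (ball xbar r) \<epsilon> \<times> ball ybar r) \<inter> gph (lim_subdiff f) =
        (ball xbar r \<times> ball ybar r) \<inter> gph (lim_subdiff fhat)"
    proof (intro equalityI subrelI)
      fix x y
      assume "(x, y) \<in> (attentive_nbhd f xbar (ball xbar r) \<epsilon> \<times> ball ybar r) \<inter> gph (lim_subdiff f)"
      then show "(x, y) \<in> (ball xbar r \<times> ball ybar r) \<inter> gph (lim_subdiff fhat)"
        using sub_hat[OF inA[of x y]] by (simp add: attentive_nbhd_def gph_def)
    next
      fix x y
      assume *: "(x, y) \<in> (ball xbar r \<times> ball ybar r) \<inter> gph (lim_subdiff fhat)"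
      then have "(x, y) \<in> A" using recover by (simp add: gph_def)
      with * show "(x, y) \<in> (attentive_nbhd f xbar (ball xbar r) \<epsilon> \<times> ball ybar r) \<inter> gph (lim_subdiff f)"
        by (simp add: attentive_nbhd_def gph_def A_def)
    qed
    show "\<forall>(x, y)\<in>(attentive_nbhd f xbar (ball xbar r) \<epsilon> \<times> ball ybar r) \<inter> gph (lim_subdiff f). f x = fhat x"
      using fhat_eq[OF inA] by (auto simp: attentive_nbhd_def gph_def)
  qed
qed

theorem theorem4p6:
  fixes f :: "'a::{real_inner, complete_space} \<Rightarrow> ereal"
    and xbar ybar :: 'a and \<kappa> :: real
  assumes "proper_fun f"
    and "xbar \<in> eff_dom f"
    and "ybar \<in> lim_subdiff f xbar"
    and "seq_weakly_lsc_around f xbar"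
  shows "variationally_convex f xbar ybar \<kappa> \<longleftrightarrow>
    (prox_regular f xbar ybar \<and>
     (\<exists>\<epsilon>>0. \<exists>U V. (xbar, ybar) \<in> interior (U \<times> V) \<and>
        lower_definite_on f \<kappa> (attentive_nbhd f xbar U \<epsilon> \<times> V)))"
proof -
  have not_minf: "f x \<noteq> -\<infinity>" for x
    using assms(1) by (simp add: proper_fun_def)
  obtain b where fx: "f xbar = ereal b"
    using assms(2) not_minf[of xbar] by (cases "f xbar") (auto simp: eff_dom_def)
  show ?thesis
    using variationally_convex_imp_prox_regular_and_lower_definite[where f = f and xbar = xbar, OF fx]
      prox_regular_and_lower_definite_imp_variationally_convex[where f = f and xbar = xbar, OF fx not_minf assms(4)]
    by blast
qed

end
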